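(* Let $\rho_1,\dots,\rho_n$ be $m\times m$ density matrices and $(\eta_1,\dots,\eta_n)$ a probability vector with all $\eta_i>0$, and let $\rho$ be the QSD-state of $\{\rho_i,\eta_i\}$ on $\mathcal H_a\otimes\mathcal H_b=\mathbb C^n\otimes\mathbb C^m$. Then $$P^{opt}_E(\{\rho_i,\eta_i\}_{i=1}^n)\le C^a_F(\rho),$$ where $C^a_F$ is taken with respect to the computational basis $\{|i\rangle\}_{i=1}^n$ of $\mathbb C^n$. Equality holds when $\rho_1,\dots,\rho_n$ are linearly independent.
   Context: The QSD-state of $\{\rho_i,\eta_i\}$ is the $mn\times mn$ block matrix with $(i,j)$-th block $\sqrt{\eta_i\rho_i}\sqrt{\eta_j\rho_j}$. Partial incoherent states: $I^a_P=\{\sum_ip_i|i\rangle\langle i|\otimes\sigma_i\}$; $C^a_F(\rho)=\min_{\sigma\in I^a_P}(1-F^2(\rho,\sigma))$ with $F(\rho,\sigma)=\mathrm{Tr}\sqrt{\sqrt\sigma\rho\sqrt\sigma}$. $P^{opt}_E(\{\rho_i,\eta_i\})=1-\max_{\{M_i\}}\sum_i\eta_i\mathrm{Tr}(M_i\rho_i)$, the maximum over all POVMs. States with spectral decompositions $\rho_i=\sum_j\lambda_{ij}|\psi_{ij}\rangle\langle\psi_{ij}|$ ($\lambda_{ij}>0$) are linearly independent if the collection $\{|\psi_{ij}\rangle\}_{i,j}$ is linearly independent. *)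

theory Defs
  imports Complex_Main "Jordan_Normal_Form.Matrix"
begin

definition adj :: "complex mat \<Rightarrow> complex mat" where
  "adj A = mat (dim_col A) (dim_row A) (\<lambda>(i,j). cnj (A $$ (j,i)))"

definition mtrace :: "complex mat \<Rightarrow> complex" where
  "mtrace A = (\<Sum>i<dim_row A. A $$ (i,i))"

definition psd :: "nat \<Rightarrow> complex mat \<Rightarrow> bool" where
  "psd d A \<longleftrightarrow> A \<in> carrier_mat d d \<and> adj A = A \<and>
     (\<forall>v \<in> carrier_vec d. 0 \<le> Re (\<Sum>a<d. \<Sum>b<d. cnj (v $ a) * A $$ (a,b) * v $ b))"

definition density :: "nat \<Rightarrow> complex mat \<Rightarrow> bool" where
  "density d A \<longleftrightarrow> psd d A \<and> mtrace A = 1"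

text \<open>The positive semidefinite square root (unique for PSD arguments).\<close>

definition msqrt :: "complex mat \<Rightarrow> complex mat" where
  "msqrt A = (THE B. psd (dim_row A) B \<and> B * B = A)"

definition fidelity :: "complex mat \<Rightarrow> complex mat \<Rightarrow> real" where
  "fidelity \<rho> \<sigma> = Re (mtrace (msqrt (msqrt \<sigma> * \<rho> * msqrt \<sigma>)))"

text \<open>QSD-state on C^n (x) C^m: index r = i*m + a (i in {0..<n}, a in {0..<m});
  the (i,j)-block is sqrt(eta_i rho_i) sqrt(eta_j rho_j).\<close>

definition qsd_state :: "nat \<Rightarrow> nat \<Rightarrow> (nat \<Rightarrow> real) \<Rightarrow> (nat \<Rightarrow> complex mat) \<Rightarrow> complex mat" where
  "qsd_state n m \<eta> \<rho> = mat (n*m) (n*m) (\<lambda>(r,c).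
     (msqrt (complex_of_real (\<eta> (r div m)) \<cdot>\<^sub>m \<rho> (r div m)) *
      msqrt (complex_of_real (\<eta> (c div m)) \<cdot>\<^sub>m \<rho> (c div m))) $$ (r mod m, c mod m))"

text \<open>Partial incoherent states sum_i p_i |i><i| (x) sigma_i (block diagonal).\<close>

definition partial_incoherent :: "nat \<Rightarrow> nat \<Rightarrow> complex mat set" where
  "partial_incoherent n m = {\<sigma>. \<exists>p \<tau>. (\<forall>i<n. 0 \<le> p i) \<and> (\<Sum>i<n. p i) = (1::real) \<and>
     (\<forall>i<n. density m (\<tau> i)) \<and>
     \<sigma> = mat (n*m) (n*m) (\<lambda>(r,c). if r div m = c div m
            then complex_of_real (p (r div m)) * \<tau> (r div m) $$ (r mod m, c mod m) else 0)}"

definition CaF :: "nat \<Rightarrow> nat \<Rightarrow> complex mat \<Rightarrow> real" where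
  "CaF n m \<rho> = (INF \<sigma> \<in> partial_incoherent n m. 1 - (fidelity \<rho> \<sigma>)\<^sup>2)"

definition povm :: "nat \<Rightarrow> nat \<Rightarrow> (nat \<Rightarrow> complex mat) \<Rightarrow> bool" where
  "povm n m M \<longleftrightarrow> (\<forall>i<n. psd m (M i)) \<and>
     (\<forall>a<m. \<forall>b<m. (\<Sum>i<n. M i $$ (a,b)) = (if a = b then 1 else 0))"

definition success_prob :: "nat \<Rightarrow> (nat \<Rightarrow> real) \<Rightarrow> (nat \<Rightarrow> complex mat) \<Rightarrow> (nat \<Rightarrow> complex mat) \<Rightarrow> real" where
  "success_prob n \<eta> \<rho> M = (\<Sum>i<n. \<eta> i * Re (mtrace (M i * \<rho> i)))"

definition PoptE :: "nat \<Rightarrow> nat \<Rightarrow> (nat \<Rightarrow> real) \<Rightarrow> (nat \<Rightarrow> complex mat) \<Rightarrow> real" where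
  "PoptE n m \<eta> \<rho> = 1 - (SUP M \<in> {M. povm n m M}. success_prob n \<eta> \<rho> M)"

definition lin_indep_states :: "nat \<Rightarrow> nat \<Rightarrow> (nat \<Rightarrow> complex mat) \<Rightarrow> bool" where
  "lin_indep_states n m \<rho> \<longleftrightarrow> (\<exists>k lam \<psi>.
     (\<forall>i<n. \<forall>j<k i. \<psi> i j \<in> carrier_vec m \<and> (0::real) < lam i j) \<and>
     (\<forall>i<n. \<forall>j<k i. \<forall>j'<k i.
        (\<Sum>a<m. \<psi> i j $ a * cnj (\<psi> i j' $ a)) = (if j = j' then 1 else 0)) \<and>
     (\<forall>i<n. \<rho> i = mat m m (\<lambda>(a,b).
        \<Sum>j<k i. complex_of_real (lam i j) * \<psi> i j $ a * cnj (\<psi> i j $ b))) \<and>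
     (\<forall>c :: nat \<Rightarrow> nat \<Rightarrow> complex.
        (\<forall>a<m. (\<Sum>i<n. \<Sum>j<k i. c i j * \<psi> i j $ a) = 0) \<longrightarrow>
        (\<forall>i<n. \<forall>j<k i. c i j = 0)))"

end

theory Submission
  imports Defs "Jordan_Normal_Form.Schur_Decomposition" "Jordan_Normal_Form.Spectral_Radius"
    "HOL-Analysis.Convex"
begin

text \<open>Put \<open>A\<^sub>i = sqrt(\<eta>\<^sub>i \<rho>\<^sub>i)\<close> and let T be the block row \<open>(A\<^sub>1 \<dots> A\<^sub>n)\<close>, so that the QSD-state is
  \<open>T* T\<close>. A partial incoherent state is \<open>S S\<close> with S block diagonal with psd blocks \<open>B\<^sub>i\<close>, and its
  fidelity with \<open>T* T\<close> is the trace norm of \<open>T S\<close>, that is, the maximum of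
  \<open>Re tr (U* T S) = \<Sum>\<^sub>i Re tr (U\<^sub>i* A\<^sub>i B\<^sub>i)\<close> over all block rows U with \<open>U U* \<le> 1\<close>.
  By Cauchy--Schwarz the square of this sum is at most \<open>\<Sum>\<^sub>i \<eta>\<^sub>i tr (U\<^sub>i U\<^sub>i* \<rho>\<^sub>i)\<close>, the success probability
  of the measurement \<open>U\<^sub>i U\<^sub>i*\<close> (completed by \<open>1 - U U*\<close>).
  Conversely, given a POVM M, let \<open>W\<^sub>i\<close> be a polar factor of \<open>sqrt(M\<^sub>i) A\<^sub>i\<close>, put
  \<open>U\<^sub>i = sqrt(M\<^sub>i) W\<^sub>i\<close>, and let \<open>B\<^sub>i\<close> be proportional to \<open>W\<^sub>i* sqrt(M\<^sub>i) A\<^sub>i\<close>; then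
  \<open>A\<^sub>i U\<^sub>i\<close> is proportional to \<open>B\<^sub>i\<close>, and Cauchy--Schwarz is an equality.\<close>

section \<open>Adjoint, trace and positive semidefinite matrices\<close>

lemma adj_carrier [simp]: "A \<in> carrier_mat n k \<Longrightarrow> adj A \<in> carrier_mat k n"
  by (auto simp: adj_def)

lemma adj_dim [simp]: "dim_row (adj A) = dim_col A" "dim_col (adj A) = dim_row A"
  by (auto simp: adj_def)

lemma adj_index [simp]: "i < dim_col A \<Longrightarrow> j < dim_row A \<Longrightarrow> adj A $$ (i,j) = cnj (A $$ (j,i))"
  by (auto simp: adj_def)

lemma adj_adj [simp]: "adj (adj A) = A"
  by (rule eq_matI) auto

lemma adj_one [simp]: "adj (1\<^sub>m n) = 1\<^sub>m n"
  by (rule eq_matI) auto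

lemma index_mult: 
  assumes "A \<in> carrier_mat n k" "B \<in> carrier_mat k l" "i < n" "j < l"
  shows "(A * B) $$ (i,j) = (\<Sum>s<k. A $$ (i,s) * B $$ (s,j))"
  using assms by (auto simp: scalar_prod_def atLeast0LessThan)

lemma adj_mult:
  assumes A: "A \<in> carrier_mat n k" and B: "B \<in> carrier_mat k l"
  shows "adj (A * B) = adj B * adj A"
proof (rule eq_matI)
  fix i j assume "i < dim_row (adj B * adj A)" "j < dim_col (adj B * adj A)"
  then have i: "i < l" and j: "j < n" using A B by auto
  have "adj (A * B) $$ (i,j) = cnj ((A * B) $$ (j,i))" using i j A B by simp
  also have "\<dots> = (\<Sum>s<k. cnj (B $$ (s,i)) * cnj (A $$ (j,s)))"
    unfolding index_mult[OF A B j i] by (simp add: mult.commute)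
  also have "\<dots> = (adj B * adj A) $$ (i,j)"
    unfolding index_mult[OF adj_carrier[OF B] adj_carrier[OF A] i j] using A B i j
    by (intro sum.cong) auto
  finally show "adj (A * B) $$ (i,j) = (adj B * adj A) $$ (i,j)" .
qed (use A B in auto)

text \<open>Stated with dimension equations instead of carriers, so that \<open>simp\<close> can
  discharge the premises and rewrite every product to right-associated form;
  \<open>adj_mult_dim\<close> and the distributivity rules below have the same shape for the same
  purpose.\<close>

lemma mat_assoc:
  fixes A B C :: "complex mat"
  assumes "dim_col A = dim_row B" "dim_col B = dim_row C"
  shows "A * B * C = A * (B * C)"
  by (rule assoc_mult_mat[of A "dim_row A" "dim_row B" B "dim_row C" C "dim_col C"])
    (use assms in \<open>auto intro: carrier_matI\<close>)

lemma adj_mult_dim: "dim_col A = dim_row B \<Longrightarrow> adj (A * B) = adj B * adj A"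
  by (rule adj_mult[of A "dim_row A" "dim_row B" B "dim_col B"]) (auto intro: carrier_matI)

text \<open>In a right-associated product the factor \<open>A * B\<close> is no longer a subterm, so
  an equation such as V* V = 1 can only be applied in this form.\<close>

lemma mat_cancel:
  fixes A B :: "complex mat"
  assumes "A * B = 1\<^sub>m n" "dim_col A = dim_row B" "dim_row X = dim_col B"
  shows "A * (B * X) = X"
proof -
  have "dim_col B = n" using arg_cong[OF assms(1), of dim_col] by simp
  then show ?thesis using assms by (simp add: mat_assoc[symmetric])
qed

lemma mult_minus_distrib_dim:
  fixes A B C :: "complex mat"
  assumes "dim_col A = dim_row B" "dim_row B = dim_row C" "dim_col B = dim_col C"
  shows "A * (B - C) = A * B - A * C"
  by (rule mult_minus_distrib_mat[of A "dim_row A" "dim_row B" B "dim_col B"])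
    (use assms in \<open>auto intro: carrier_matI\<close>)

lemma minus_mult_distrib_dim:
  fixes A B C :: "complex mat"
  assumes "dim_row A = dim_row B" "dim_col A = dim_col B" "dim_col A = dim_row C"
  shows "(A - B) * C = A * C - B * C"
  by (rule minus_mult_distrib_mat[of A "dim_row A" "dim_col A" B C "dim_col C"])
    (use assms in \<open>auto intro: carrier_matI\<close>)

lemma adj_add:
  "A \<in> carrier_mat n k \<Longrightarrow> B \<in> carrier_mat n k \<Longrightarrow> adj (A + B) = adj A + adj B"
  by (rule eq_matI) auto

lemma adj_minus:
  "A \<in> carrier_mat n k \<Longrightarrow> B \<in> carrier_mat n k \<Longrightarrow> adj (A - B) = adj A - adj B"
  by (rule eq_matI) auto

lemma adj_smult: "adj (complex_of_real c \<cdot>\<^sub>m A) = complex_of_real c \<cdot>\<^sub>m adj A"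
  by (rule eq_matI) auto

section \<open>The trace and the Hilbert-Schmidt inner product\<close>

lemma mtrace_mult:
  assumes "A \<in> carrier_mat n k" "B \<in> carrier_mat k n"
  shows "mtrace (A * B) = (\<Sum>i<n. \<Sum>s<k. A $$ (i,s) * B $$ (s,i))"
  using assms by (simp add: mtrace_def index_mult[OF assms] del: index_mult_mat(1))

lemma mtrace_comm:
  assumes "A \<in> carrier_mat n k" "B \<in> carrier_mat k n"
  shows "mtrace (A * B) = mtrace (B * A)"
  unfolding mtrace_mult[OF assms] mtrace_mult[OF assms(2,1)]
  by (subst sum.swap) (simp add: mult.commute)

lemma mtrace_add:
  "A \<in> carrier_mat n n \<Longrightarrow> B \<in> carrier_mat n n \<Longrightarrow> mtrace (A + B) = mtrace A + mtrace B"
  by (simp add: mtrace_def sum.distrib)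

lemma mtrace_smult: "A \<in> carrier_mat n n \<Longrightarrow> mtrace (c \<cdot>\<^sub>m A) = c * mtrace A"
  by (simp add: mtrace_def sum_distrib_left)

text \<open>This trace is the Hilbert-Schmidt inner product of A and B; the entrywise form makes
  positivity, definiteness and Cauchy-Schwarz statements about finite sums.\<close>

lemma mtrace_gram:
  assumes "A \<in> carrier_mat n k" "B \<in> carrier_mat n k"
  shows "mtrace (adj A * B) = (\<Sum>j<k. \<Sum>i<n. cnj (A $$ (i,j)) * B $$ (i,j))"
  unfolding mtrace_mult[OF adj_carrier[OF assms(1)] assms(2)]
  using assms by (intro sum.cong refl) auto

lemma Re_mtrace_gram_self:
  assumes "A \<in> carrier_mat n k"
  shows "Re (mtrace (adj A * A)) = (\<Sum>j<k. \<Sum>i<n. (cmod (A $$ (i,j)))\<^sup>2)"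
  unfolding mtrace_gram[OF assms assms]
  by (simp add: cmod_power2) (simp add: power2_eq_square)

lemma Re_mtrace_gram_nonneg: "0 \<le> Re (mtrace (adj A * A))"
  by (simp add: Re_mtrace_gram_self[of A "dim_row A" "dim_col A"] sum_nonneg)

lemma gram_zero_imp_zero:
  assumes A: "A \<in> carrier_mat n k" and z: "Re (mtrace (adj A * A)) = 0"
  shows "A = 0\<^sub>m n k"
proof (rule eq_matI)
  fix i j assume "i < dim_row (0\<^sub>m n k :: complex mat)" "j < dim_col (0\<^sub>m n k :: complex mat)"
  then have i: "i < n" and j: "j < k" by auto
  have "(\<Sum>j<k. \<Sum>i<n. (cmod (A $$ (i,j)))\<^sup>2) = 0"
    using z Re_mtrace_gram_self[OF A] by simp
  then have "(\<Sum>i<n. (cmod (A $$ (i,j)))\<^sup>2) = 0"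
    using j by (subst (asm) sum_nonneg_eq_0_iff) (auto intro: sum_nonneg)
  then have "(cmod (A $$ (i,j)))\<^sup>2 = 0"
    using i by (subst (asm) sum_nonneg_eq_0_iff) auto
  then show "A $$ (i,j) = 0\<^sub>m n k $$ (i,j)" using i j by simp
qed (use A in auto)

text \<open>The triangle inequality replaces the entries by their moduli, after which the real
  Cauchy-Schwarz inequality over all index pairs applies.\<close>

lemma Re_mtrace_gram_Cauchy_Schwarz:
  assumes A: "A \<in> carrier_mat n k" and B: "B \<in> carrier_mat n k"
  shows "(Re (mtrace (adj A * B)))\<^sup>2 \<le> Re (mtrace (adj A * A)) * Re (mtrace (adj B * B))"
proof -
  let ?S = "{..<k} \<times> {..<n}"
  let ?a = "\<lambda>(j,i). cmod (A $$ (i,j))" and ?b = "\<lambda>(j,i). cmod (B $$ (i,j))"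
  have aa: "Re (mtrace (adj A * A)) = (\<Sum>x\<in>?S. (?a x)\<^sup>2)"
    unfolding Re_mtrace_gram_self[OF A] by (simp add: sum.cartesian_product case_prod_unfold)
  have bb: "Re (mtrace (adj B * B)) = (\<Sum>x\<in>?S. (?b x)\<^sup>2)"
    unfolding Re_mtrace_gram_self[OF B] by (simp add: sum.cartesian_product case_prod_unfold)
  have "\<bar>Re (mtrace (adj A * B))\<bar> \<le> cmod (mtrace (adj A * B))" by (rule abs_Re_le_cmod)
  also have "cmod (mtrace (adj A * B)) = cmod (\<Sum>x\<in>?S. cnj (A $$ (snd x,fst x)) * B $$ (snd x,fst x))"
    unfolding mtrace_gram[OF A B] by (simp add: sum.cartesian_product case_prod_unfold)
  also have "\<dots> \<le> (\<Sum>x\<in>?S. ?a x * ?b x)"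
    by (rule order_trans[OF norm_sum]) (simp add: norm_mult case_prod_unfold)
  finally have "(Re (mtrace (adj A * B)))\<^sup>2 \<le> (\<Sum>x\<in>?S. ?a x * ?b x)\<^sup>2"
    by (rule abs_le_square_iff[THEN iffD1, OF order_trans[OF _ abs_ge_self]])
  also have "\<dots> \<le> (\<Sum>x\<in>?S. (?a x)\<^sup>2) * (\<Sum>x\<in>?S. (?b x)\<^sup>2)"
    by (rule Cauchy_Schwarz_ineq_sum)
  finally show ?thesis unfolding aa bb .
qed

text \<open>Vectors become one-column matrices, so that the quadratic form is the trace of a product
  and the matrix algebra above replaces double sums.\<close>

lemma psd_iff:
  "psd d A \<longleftrightarrow> A \<in> carrier_mat d d \<and> adj A = A \<and>
     (\<forall>X \<in> carrier_mat d 1. 0 \<le> Re (mtrace (adj X * (A * X))))"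
proof -
  have eq: "mtrace (adj X * (A * X)) = (\<Sum>a<d. \<Sum>b<d. cnj (X $$ (a,0)) * A $$ (a,b) * X $$ (b,0))"
    if A: "A \<in> carrier_mat d d" and X: "X \<in> carrier_mat d 1" for X
    unfolding mtrace_gram[OF X mult_carrier_mat[OF A X]]
    by (simp add: index_mult[OF A X] sum_distrib_left mult.assoc del: index_mult_mat)
  show ?thesis (is "?L \<longleftrightarrow> ?R")
  proof
    assume L: ?L
    show ?R
    proof (intro conjI ballI)
      fix X :: "complex mat" assume X: "X \<in> carrier_mat d 1"
      have "(\<Sum>a<d. \<Sum>b<d. cnj (X $$ (a,0)) * A $$ (a,b) * X $$ (b,0)) = 
        (\<Sum>a<d. \<Sum>b<d. cnj (vec d (\<lambda>i. X $$ (i,0)) $ a) * A $$ (a,b) * vec d (\<lambda>i. X $$ (i,0)) $ b)"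
        by (intro sum.cong) auto
      then show "0 \<le> Re (mtrace (adj X * (A * X)))"
        using L X unfolding psd_def by (subst eq) (auto simp del: index_vec)
    qed (use L in \<open>auto simp: psd_def\<close>)
  next
    assume R: ?R
    then have A: "A \<in> carrier_mat d d" by simp
    show ?L unfolding psd_def
    proof (intro conjI ballI)
      fix v :: "complex vec" assume "v \<in> carrier_vec d"
      let ?X = "mat d 1 (\<lambda>(i,j). v $ i)"
      have "(\<Sum>a<d. \<Sum>b<d. cnj (v $ a) * A $$ (a,b) * v $ b) = mtrace (adj ?X * (A * ?X))"
        by (subst eq[OF A]) (auto intro!: sum.cong)
      then show "0 \<le> Re (\<Sum>a<d. \<Sum>b<d. cnj (v $ a) * A $$ (a,b) * v $ b)"
        using R by simp
    qed (use R in auto)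
  qed
qed

lemma psdD:
  assumes "psd d A" shows "A \<in> carrier_mat d d" "adj A = A"
  using assms by (auto simp: psd_def)

text \<open>The quadratic form at X is the squared norm of \<open>K * X\<close>. Nearly every later
  positivity claim is proved by exhibiting such a factorization.\<close>

lemma psd_gram:
  assumes K: "K \<in> carrier_mat k d"
  shows "psd d (adj K * K)"
  unfolding psd_iff
proof (intro conjI ballI)
  show "adj (adj K * K) = adj K * K" using adj_mult[OF adj_carrier[OF K] K] by simp
  fix X :: "complex mat" assume X: "X \<in> carrier_mat d 1"
  have "adj X * (adj K * K * X) = adj (K * X) * (K * X)"
    using K X adj_carrier[OF K] adj_carrier[OF X]
    by (simp add: adj_mult[OF K X] mat_assoc)
  then show "0 \<le> Re (mtrace (adj X * (adj K * K * X)))" by (simp add: Re_mtrace_gram_nonneg)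
qed (use K in auto)

lemma psd_add:
  assumes A: "psd d A" and B: "psd d B" shows "psd d (A + B)"
proof -
  note c = psdD(1)[OF A] psdD(1)[OF B]
  show ?thesis unfolding psd_iff
  proof (intro conjI ballI)
    fix X :: "complex mat" assume X: "X \<in> carrier_mat d 1"
    have "adj X * ((A + B) * X) = adj X * (A * X) + adj X * (B * X)"
      using c X adj_carrier[OF X]
      by (simp add: add_mult_distrib_mat[OF c X] mult_add_distrib_mat[of _ 1 d _ 1])
    moreover have "adj X * (A * X) \<in> carrier_mat 1 1" "adj X * (B * X) \<in> carrier_mat 1 1"
      using c X adj_carrier[OF X] by (meson mult_carrier_mat)+
    ultimately show "0 \<le> Re (mtrace (adj X * ((A + B) * X)))"
      using A B X by (simp add: mtrace_add[of _ 1] psd_iff del: One_nat_def)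
  qed (use c psdD(2)[OF A] psdD(2)[OF B] in \<open>auto simp: adj_add\<close>)
qed

lemma psd_smult:
  assumes A: "psd d A" and c: "0 \<le> c" shows "psd d (complex_of_real c \<cdot>\<^sub>m A)"
proof -
  note cA = psdD(1)[OF A]
  show ?thesis unfolding psd_iff
  proof (intro conjI ballI)
    fix X :: "complex mat" assume X: "X \<in> carrier_mat d 1"
    note AX = mult_carrier_mat[OF cA X]
    have "adj X * ((complex_of_real c \<cdot>\<^sub>m A) * X) = complex_of_real c \<cdot>\<^sub>m (adj X * (A * X))"
      by (simp only: mult_smult_assoc_mat[OF cA X] mult_smult_distrib[OF adj_carrier[OF X] AX])
    moreover have "0 \<le> Re (mtrace (adj X * (A * X)))" using A X by (simp add: psd_iff)
    ultimately show "0 \<le> Re (mtrace (adj X * ((complex_of_real c \<cdot>\<^sub>m A) * X)))"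
      using c by (simp add: mtrace_smult[OF mult_carrier_mat[OF adj_carrier[OF X] AX]])
  qed (use cA psdD(2)[OF A] in \<open>auto simp: adj_smult\<close>)
qed

section \<open>Diagonalization of Hermitian matrices\<close>

definition dg :: "nat \<Rightarrow> (nat \<Rightarrow> real) \<Rightarrow> complex mat" where
  "dg n d = mat n n (\<lambda>(i,j). if i = j then complex_of_real (d i) else 0)"

lemma dg_carrier [simp]: "dg n d \<in> carrier_mat n n" by (simp add: dg_def)

lemma adj_dg [simp]: "adj (dg n d) = dg n d"
  by (rule eq_matI) (auto simp: dg_def)

lemma dg_mult: "dg n d * dg n e = dg n (\<lambda>i. d i * e i)"
proof (rule eq_matI)
  fix i j assume "i < dim_row (dg n (\<lambda>i. d i * e i))" "j < dim_col (dg n (\<lambda>i. d i * e i))"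
  then have "i < n" "j < n" by (auto simp: dg_def)
  then show "(dg n d * dg n e) $$ (i,j) = dg n (\<lambda>i. d i * e i) $$ (i,j)"
    by (subst index_mult[OF dg_carrier dg_carrier])
      (auto simp: dg_def if_distrib[of "\<lambda>x. x * _"] cong: if_cong)
qed (auto simp: dg_def)

text \<open>Completing v to a basis and applying Gram-Schmidt gives pairwise orthogonal vectors the
  first of which is still v; dividing each by its norm gives the columns of U, and c is the factor
  1/|v|.\<close>

lemma unitary_with_first_column:
  fixes v :: "complex vec"
  assumes v: "v \<in> carrier_vec n" and v0: "v \<noteq> 0\<^sub>v n"
  shows "\<exists>U c. U \<in> carrier_mat n n \<and> adj U * U = 1\<^sub>m n \<and> c \<noteq> 0 \<and> col U 0 = c \<cdot>\<^sub>v v"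
proof -
  define b where "b = basis_completion v"
  define ws where "ws = gram_schmidt n b"
  have n: "n \<noteq> 0" using v v0 by auto
  interpret cof_vec_space n "TYPE(complex)" .
  from basis_completion[OF v v0, folded b_def]
  have dist_b: "distinct b" and indep: "\<not> lin_dep (set b)" and b: "set b \<subseteq> carrier_vec n" 
    and hdb: "hd b = v" and len_b: "length b = n" by auto
  from hdb len_b n obtain vs where bv: "b = v # vs" by (cases b, auto)
  from gram_schmidt_result[OF b dist_b indep refl, folded ws_def]
  have ws: "set ws \<subseteq> carrier_vec n" "corthogonal ws" "length ws = n" 
    by (auto simp: len_b)
  from gram_schmidt_hd[OF v, of vs, folded bv] have hdws: "hd ws = v" unfolding ws_def .
  have ws0: "ws ! 0 = v" using hdws ws(3) n by (metis hd_conv_nth list.size(3))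
  define N where "N i = (\<Sum>a<n. (cmod (ws ! i $ a))\<^sup>2)" for i
  define c where "c i = complex_of_real (1 / sqrt (N i))" for i
  have wsc: "ws ! i \<in> carrier_vec n" if "i < n" for i using that ws by auto
  have inner: "ws ! j \<bullet>c ws ! i = (\<Sum>a<n. cnj (ws ! i $ a) * ws ! j $ a)" if "i < n" "j < n" for i j
    using wsc[OF that(1)] wsc[OF that(2)]
    by (auto simp: scalar_prod_def atLeast0LessThan mult.commute intro!: sum.cong)
  have self: "ws ! i \<bullet>c ws ! i = complex_of_real (N i)" if "i < n" for i
    unfolding inner[OF that that] N_def of_real_sum complex_norm_square by (simp add: mult.commute)
  have Npos: "N i > 0" if "i < n" for i
  proof -
    have "N i \<noteq> 0" using corthogonalD[OF ws(2), of i i] self[OF that] that ws(3) by auto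
    moreover have "N i \<ge> 0" unfolding N_def by (auto intro: sum_nonneg)
    ultimately show ?thesis by simp
  qed
  define U where "U = mat n n (\<lambda>(a,i). c i * ws ! i $ a)"
  have U: "U \<in> carrier_mat n n" by (simp add: U_def)
  have "adj U * U = 1\<^sub>m n"
  proof (rule eq_matI)
    fix i j assume "i < dim_row (1\<^sub>m n :: complex mat)" "j < dim_col (1\<^sub>m n :: complex mat)"
    then have i: "i < n" and j: "j < n" by auto
    have "(adj U * U) $$ (i,j) = (\<Sum>a<n. cnj (c i * ws ! i $ a) * (c j * ws ! j $ a))"
      unfolding index_mult[OF adj_carrier[OF U] U i j] using i j by (intro sum.cong) (auto simp: U_def)
    also have "\<dots> = cnj (c i) * c j * (\<Sum>a<n. cnj (ws ! i $ a) * ws ! j $ a)"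
      by (simp add: sum_distrib_left mult_ac)
    also have "\<dots> = cnj (c i) * c j * (ws ! j \<bullet>c ws ! i)" unfolding inner[OF i j] ..
    also have "\<dots> = (if i = j then 1 else 0)"
    proof (cases "i = j")
      case True
      have "cnj (c i) * c i * (ws ! i \<bullet>c ws ! i) = complex_of_real (1 / sqrt (N i) * (1 / sqrt (N i)) * N i)"
        unfolding self[OF i] c_def by (simp only: complex_cnj_complex_of_real of_real_mult)
      also have "1 / sqrt (N i) * (1 / sqrt (N i)) * N i = 1" using Npos[OF i] by simp
      finally show ?thesis using True by simp
    next
      case False
      then show ?thesis using corthogonalD[OF ws(2), of j i] i j ws(3) by simp
    qed
    finally show "(adj U * U) $$ (i,j) = 1\<^sub>m n $$ (i,j)" using i j by simp
  qed (use U in auto)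
  moreover have "col U 0 = c 0 \<cdot>\<^sub>v v"
    using n v ws0 by (intro eq_vecI) (auto simp: U_def)
  moreover have "c 0 \<noteq> 0" using Npos[of 0] n by (simp add: c_def)
  ultimately show ?thesis using U by blast
qed

lemma adj_four_block:
  assumes "A \<in> carrier_mat a c" "B \<in> carrier_mat a d" "C \<in> carrier_mat b c" "D \<in> carrier_mat b d"
  shows "adj (four_block_mat A B C D) = four_block_mat (adj A) (adj C) (adj B) (adj D)"
  using assms by (intro eq_matI) auto

lemma mult_four_block_diag:
  fixes A :: "complex mat"
  assumes "A \<in> carrier_mat a a" "A' \<in> carrier_mat a a" "D \<in> carrier_mat b b" "D' \<in> carrier_mat b b"
  shows "four_block_mat A (0\<^sub>m a b) (0\<^sub>m b a) D * four_block_mat A' (0\<^sub>m a b) (0\<^sub>m b a) D'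
    = four_block_mat (A * A') (0\<^sub>m a b) (0\<^sub>m b a) (D * D')"
  using assms
  by (subst mult_four_block_mat[OF assms(1) zero_carrier_mat zero_carrier_mat assms(3) assms(2)
        zero_carrier_mat zero_carrier_mat assms(4)])
    (simp add: right_add_zero_mat[OF mult_carrier_mat] left_add_zero_mat[OF mult_carrier_mat])

text \<open>\<open>case_nat e d\<close> puts the value e in front of the sequence d, as the
  induction step of the diagonalization requires.\<close>

lemma dg_Suc:
  "dg (Suc n) (case_nat e d) = four_block_mat (dg 1 (\<lambda>_. e)) (0\<^sub>m 1 n) (0\<^sub>m n 1) (dg n d)"
  by (rule eq_matI) (auto simp: dg_def four_block_mat_def Let_def split: nat.splits)

text \<open>Induction on the size. A unitary U whose first column is an eigenvector turns A into B =
  U* A U, whose first column is e times the first unit vector. Since B is Hermitian, e is real and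
  the rest of the first row vanishes too, so the induction hypothesis applies to the remaining
  block.\<close>

theorem hermitian_diagonalization:
  assumes "A \<in> carrier_mat n n" "adj A = A"
  shows "\<exists>V d. V \<in> carrier_mat n n \<and> adj V * V = 1\<^sub>m n \<and> V * adj V = 1\<^sub>m n \<and> A = V * dg n d * adj V"
proof -
  \<comment> \<open>The induction carries only one of the two unitarity equations; the other follows
    at the end because V is square.\<close>
  have "\<exists>V d. V \<in> carrier_mat n n \<and> adj V * V = 1\<^sub>m n \<and> adj V * A * V = dg n d"
    using assms
  proof (induction n arbitrary: A)
    case 0
    then show ?case
      by (intro exI[of _ "1\<^sub>m 0"] exI[of _ "\<lambda>_. 0"] conjI) (simp, (rule eq_matI; simp add: dg_def)+)
  next
    case (Suc n)
    note A = Suc.prems(1)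
    from spectrum_non_empty[OF A] obtain e where "eigenvalue A e" by (auto simp: spectrum_def)
    then obtain v where v: "v \<in> carrier_vec (Suc n)" "v \<noteq> 0\<^sub>v (Suc n)" and ev: "A *\<^sub>v v = e \<cdot>\<^sub>v v"
      using A by (auto simp: eigenvalue_def eigenvector_def)
    from unitary_with_first_column[OF v] obtain U c where U: "U \<in> carrier_mat (Suc n) (Suc n)"
      and UU: "adj U * U = 1\<^sub>m (Suc n)" and c: "c \<noteq> 0" and U0: "col U 0 = c \<cdot>\<^sub>v v" by blast
    note aU = adj_carrier[OF U]
    define B where "B = adj U * A * U"
    have B: "B \<in> carrier_mat (Suc n) (Suc n)" unfolding B_def using A U aU by auto
    have hB: "adj B = B"
      unfolding B_def using A U aU Suc.prems(2)
      by (simp add: adj_mult_dim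
          mat_assoc)
    have col: "B $$ (i,0) = (if i = 0 then e else 0)" if i: "i < Suc n" for i
    proof -
      have "B = adj U * (A * U)"
        unfolding B_def using A U aU by (simp add: mat_assoc)
      then have "B $$ (i,0) = row (adj U) i \<bullet> col (A * U) 0" using i U A by simp
      also have "col (A * U) 0 = A *\<^sub>v col U 0" using A U by (auto simp: col_mult2[OF A U])
      also have "A *\<^sub>v col U 0 = e \<cdot>\<^sub>v col U 0"
        unfolding U0 using A v ev by (simp add: mult_mat_vec smult_smult_assoc mult.commute)
      also have "row (adj U) i \<bullet> (e \<cdot>\<^sub>v col U 0) = e * (row (adj U) i \<bullet> col U 0)"
        using U by (intro scalar_prod_smult_distrib[of _ "Suc n"]) (simp_all add: carrier_vecI)
      also have "row (adj U) i \<bullet> col U 0 = (adj U * U) $$ (i,0)" using i U by simp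
      finally show ?thesis unfolding UU using i by auto
    qed
    have e: "e = complex_of_real (Re e)"
    proof -
      have "B $$ (0,0) = cnj (B $$ (0,0))" using arg_cong[OF hB, of "\<lambda>X. X $$ (0,0)"] B by simp
      then have "e = cnj e" using col[of 0] by simp
      then show ?thesis by (simp add: complex_eq_iff)
    qed
    define C where "C = mat n n (\<lambda>(i,j). B $$ (Suc i, Suc j))"
    have C: "C \<in> carrier_mat n n" by (simp add: C_def)
    have row: "B $$ (0,Suc j) = 0" if "j < n" for j
    proof -
      have "B $$ (0,Suc j) = cnj (B $$ (Suc j,0))" 
        using arg_cong[OF hB, of "\<lambda>X. X $$ (0,Suc j)"] B that by simp
      then show ?thesis using col[of "Suc j"] that by simp
    qed
    have Bblock: "B = four_block_mat (dg 1 (\<lambda>_. Re e)) (0\<^sub>m 1 n) (0\<^sub>m n 1) C" (is "_ = ?R")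
    proof (rule eq_matI)
      fix i j assume "i < dim_row ?R" "j < dim_col ?R"
      then have ij: "i < Suc n" "j < Suc n" by (auto simp: C_def dg_def)
      show "B $$ (i,j) = ?R $$ (i,j)"
        using ij col[of i] e row by (cases i; cases j) (auto simp: C_def dg_def)
    qed (use B in \<open>auto simp: C_def dg_def\<close>)
    have hC: "adj C = C"
    proof (rule eq_matI)
      fix i j assume "i < dim_row C" "j < dim_col C"
      then have ij: "i < n" "j < n" by (auto simp: C_def)
      then have "B $$ (Suc i,Suc j) = cnj (B $$ (Suc j,Suc i))" 
        using arg_cong[OF hB, of "\<lambda>X. X $$ (Suc i,Suc j)"] B by simp
      then show "adj C $$ (i,j) = C $$ (i,j)" using ij by (simp add: C_def)
    qed (auto simp: C_def)
    from Suc.IH[OF C hC] obtain W d where W: "W \<in> carrier_mat n n" and WW: "adj W * W = 1\<^sub>m n"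
      and WC: "adj W * C * W = dg n d" by blast
    \<comment> \<open>U splits off the eigenvalue and P lets W act on the remaining coordinates, so
      \<open>U * P\<close> diagonalizes A.\<close>
    define P where "P = four_block_mat (1\<^sub>m 1) (0\<^sub>m 1 n) (0\<^sub>m n 1) W"
    have P: "P \<in> carrier_mat (Suc n) (Suc n)" 
      unfolding P_def using four_block_carrier_mat[of "1\<^sub>m 1" 1 1 W n n] W by simp
    have aP: "adj P = four_block_mat (1\<^sub>m 1) (0\<^sub>m 1 n) (0\<^sub>m n 1) (adj W)"
      unfolding P_def using W by (subst adj_four_block[of _ 1 1 _ n _ n]) (auto intro!: arg_cong2[where f="\<lambda>x y. four_block_mat _ x y _"] eq_matI)
    have PP: "adj P * P = 1\<^sub>m (Suc n)"
      unfolding aP unfolding P_def using W adj_carrier[OF W]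
      by (subst mult_four_block_mat[of _ 1 1 _ n _ n _ _ 1 _ n]) (auto simp: WW)
    have PBP: "adj P * B * P = dg (Suc n) (case_nat (Re e) d)"
      unfolding dg_Suc aP Bblock unfolding P_def using W C adj_carrier[OF W]
      by (simp only: mult_four_block_diag[OF one_carrier_mat dg_carrier adj_carrier[OF W] C]
          mult_four_block_diag[OF dg_carrier one_carrier_mat
            mult_carrier_mat[OF adj_carrier[OF W] C] W] WC
          left_mult_one_mat[OF dg_carrier] right_mult_one_mat[OF dg_carrier])
    have 1: "adj (U * P) * (U * P) = 1\<^sub>m (Suc n)"
      using U P by (simp add: adj_mult_dim mat_assoc mat_cancel[OF UU] PP)
    have "adj (U * P) * A * (U * P) = adj P * B * P"
      unfolding B_def
      using A U P aU adj_carrier[OF P] by (simp add: adj_mult_dim mat_assoc)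
    with 1 PBP show ?case using U P by (intro exI[of _ "U * P"]) auto
  qed
  then obtain V d where V: "V \<in> carrier_mat n n" and VV: "adj V * V = 1\<^sub>m n" 
    and VA: "adj V * A * V = dg n d" by blast
  note aV = adj_carrier[OF V]
  have VV': "V * adj V = 1\<^sub>m n" by (rule mat_mult_left_right_inverse[OF aV V VV])
  have "A = V * dg n d * adj V"
    unfolding VA[symmetric] using V aV assms(1) by (simp add: mat_assoc mat_cancel[OF VV'] VV')
  with V VV VV' show ?thesis by blast
qed

section \<open>Square roots\<close>

lemma dg_dim [simp]: "dim_row (dg n d) = n" "dim_col (dg n d) = n"
  by (simp_all add: dg_def)

lemma dg_index [simp]: "i < n \<Longrightarrow> j < n \<Longrightarrow> dg n d $$ (i,j) = (if i = j then complex_of_real (d i) else 0)"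
  by (simp add: dg_def)

lemma mtrace_dg: "mtrace (dg n d) = complex_of_real (\<Sum>i<n. d i)"
  by (simp add: mtrace_def dg_def)

lemma unitary_conj_dg:
  assumes V: "V \<in> carrier_mat n n" and VV: "adj V * V = 1\<^sub>m n"
  shows "(V * dg n d * adj V) * (V * dg n e * adj V) = V * dg n (\<lambda>i. d i * e i) * adj V"
    and "adj (V * dg n d * adj V) = V * dg n d * adj V"
    and "mtrace (V * dg n d * adj V) = complex_of_real (\<Sum>i<n. d i)"
proof -
  note c = V adj_carrier[OF V] dg_carrier
  note d = carrier_matD[OF V]
  have "(V * dg n d * adj V) * (V * dg n e * adj V) = V * (dg n d * dg n e) * adj V"
    by (simp add: mat_assoc d mat_cancel[OF VV])
  then show "(V * dg n d * adj V) * (V * dg n e * adj V) = V * dg n (\<lambda>i. d i * e i) * adj V"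
    unfolding dg_mult .
  show "adj (V * dg n d * adj V) = V * dg n d * adj V"
    by (simp add: mat_assoc d adj_mult_dim)
  have "mtrace (V * dg n d * adj V) = mtrace (adj V * (V * dg n d))"
    using c by (intro mtrace_comm[of _ n n]) auto
  also have "adj V * (V * dg n d) = dg n d"
    by (simp add: mat_cancel[OF VV] d)
  finally show "mtrace (V * dg n d * adj V) = complex_of_real (\<Sum>i<n. d i)" by (simp add: mtrace_dg)
qed

text \<open>The value \<open>d i\<close> is the quadratic form of A at the i-th column of V, hence
  nonnegative. That column is written as \<open>V * ?e\<close>, with \<open>?e\<close> the i-th unit
  vector, so that V cancels.\<close>

lemma psd_diagonalization:
  assumes A: "psd n A"
  shows "\<exists>V d. V \<in> carrier_mat n n \<and> adj V * V = 1\<^sub>m n \<and> V * adj V = 1\<^sub>m n \<and> (\<forall>i<n. 0 \<le> d i) \<and> 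
     A = V * dg n d * adj V"
proof -
  from hermitian_diagonalization[OF psdD[OF A]] obtain V d where V: "V \<in> carrier_mat n n"
    and VV: "adj V * V = 1\<^sub>m n" "V * adj V = 1\<^sub>m n" and Ad: "A = V * dg n d * adj V" by blast
  note c = V adj_carrier[OF V] dg_carrier
  have "0 \<le> d i" if i: "i < n" for i
  proof -
    let ?X = "mat n 1 (\<lambda>(a,_). V $$ (a,i))"
    let ?e = "mat n 1 (\<lambda>(a,_). if a = i then 1 else 0) :: complex mat"
    have X: "?X = V * ?e"
    proof (rule eq_matI)
      fix a b assume "a < dim_row (V * ?e)" "b < dim_col (V * ?e)"
      then have "a < n" "b < 1" using V by auto
      then show "?X $$ (a,b) = (V * ?e) $$ (a,b)"
        using i by (subst index_mult[OF V, of ?e 1]) (auto simp: if_distrib[of "\<lambda>x. _ * x"] cong: if_cong)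
    qed (use V in auto)
    have e: "?e \<in> carrier_mat n 1" by simp
    have "adj ?X * (A * ?X) = adj ?e * (dg n d * ?e)"
      unfolding X Ad by (simp add: mat_assoc carrier_matD[OF V] adj_mult_dim mat_cancel[OF VV(1)])
    then have "mtrace (adj ?X * (A * ?X)) = mtrace (adj ?e * (dg n d * ?e))" by simp
    also have "\<dots> = (\<Sum>a<n. cnj (?e $$ (a,0)) * (dg n d * ?e) $$ (a,0))"
      unfolding mtrace_gram[OF e mult_carrier_mat[OF dg_carrier e]] by simp
    also have "\<dots> = (\<Sum>a<n. if a = i then complex_of_real (d i) else 0)"
    proof (intro sum.cong refl)
      fix a assume a: "a \<in> {..<n}"
      show "cnj (?e $$ (a,0)) * (dg n d * ?e) $$ (a,0) = (if a = i then complex_of_real (d i) else 0)"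
        using a i by (subst index_mult[OF dg_carrier e]) (auto simp: if_distrib[of "\<lambda>x. _ * x"] cong: if_cong)
    qed
    also have "\<dots> = complex_of_real (d i)" using i by simp
    finally have "d i = Re (mtrace (adj ?X * (A * ?X)))" by simp
    then show ?thesis using A unfolding psd_iff by simp
  qed
  with V VV Ad show ?thesis by blast
qed

lemma dg_sqrt_squared: "\<forall>i<n. 0 \<le> d i \<Longrightarrow> dg n (\<lambda>i. sqrt (d i) * sqrt (d i)) = dg n d"
  by (intro eq_matI) (auto simp: dg_def)

text \<open>The matrix is the Gram matrix of the one with \<open>sqrt (d i)\<close> in place of
  \<open>d i\<close>.\<close>

lemma psd_dg:
  assumes V: "V \<in> carrier_mat n n" and VV: "adj V * V = 1\<^sub>m n" and d: "\<forall>i<n. 0 \<le> d i"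
  shows "psd n (V * dg n d * adj V)"
proof -
  let ?R = "V * dg n (\<lambda>i. sqrt (d i)) * adj V"
  have "adj ?R * ?R = V * dg n (\<lambda>i. sqrt (d i) * sqrt (d i)) * adj V"
    unfolding unitary_conj_dg(2)[OF V VV] unitary_conj_dg(1)[OF V VV] ..
  also have "dg n (\<lambda>i. sqrt (d i) * sqrt (d i)) = dg n d" using d by (rule dg_sqrt_squared)
  finally have "adj ?R * ?R = V * dg n d * adj V" .
  moreover have "?R \<in> carrier_mat n n" using V by (auto intro!: carrier_matI)
  ultimately show ?thesis using psd_gram[of ?R n n] by metis
qed

lemma psd_sqrt_ex:
  assumes A: "psd n A" shows "\<exists>B. psd n B \<and> B * B = A"
proof -
  from psd_diagonalization[OF A] obtain V d where V: "V \<in> carrier_mat n n"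
    and VV: "adj V * V = 1\<^sub>m n" and d: "\<forall>i<n. 0 \<le> d i" and Ad: "A = V * dg n d * adj V" by blast
  let ?R = "V * dg n (\<lambda>i. sqrt (d i)) * adj V"
  have "psd n ?R" using d by (intro psd_dg V VV) auto
  moreover have "?R * ?R = A"
    unfolding unitary_conj_dg(1)[OF V VV] dg_sqrt_squared[OF d] Ad ..
  ultimately show ?thesis by blast
qed

text \<open>With R a square root of A, the product K* A K is the Gram matrix of
  \<open>R * K\<close>.\<close>

lemma psd_congruence:
  assumes A: "psd n A" and K: "K \<in> carrier_mat n k"
  shows "psd k (adj K * A * K)"
proof -
  from psd_sqrt_ex[OF A] obtain R where R: "psd n R" and RR: "R * R = A" by blast
  note c = psdD[OF R] K adj_carrier[OF K]
  have "adj (R * K) * (R * K) = adj K * A * K"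
    by (simp add: RR[symmetric] mat_assoc adj_mult_dim c(2) carrier_matD[OF c(1)] carrier_matD[OF K])
  then show ?thesis using psd_gram[of "R * K" n k] c by simp
qed

section \<open>Traces of positive semidefinite matrices and of their products\<close>

lemma psd_trace_nonneg:
  assumes "psd n A" shows "0 \<le> Re (mtrace A)"
proof -
  from psd_sqrt_ex[OF assms] obtain R where R: "psd n R" "R * R = A" by blast
  then show ?thesis using Re_mtrace_gram_nonneg[of R] psdD[OF R(1)] by simp
qed

text \<open>With R a square root of B, cyclicity turns tr(A B) into tr(R A R), the trace of a
  congruence of A; the product A B itself need not be Hermitian.\<close>

lemma psd_trace_mult_nonneg:
  assumes A: "psd n A" and B: "psd n B" shows "0 \<le> Re (mtrace (A * B))"
proof -
  from psd_sqrt_ex[OF B] obtain R where R: "psd n R" and RR: "R * R = B" by blast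
  note c = psdD[OF A] psdD[OF R]
  have "mtrace (A * B) = mtrace (A * R * R)" unfolding RR[symmetric] using c by (simp add: mat_assoc)
  also have "\<dots> = mtrace (R * (A * R))" using c by (intro mtrace_comm[of _ n n]) auto
  also have "R * (A * R) = adj R * A * R" using c by (simp add: mat_assoc)
  finally show ?thesis using psd_trace_nonneg[OF psd_congruence[OF A c(3)]] by simp
qed

lemma minus_mult_self_eq:
  fixes B C :: "complex mat"
  assumes "B \<in> carrier_mat n n" "C \<in> carrier_mat n n" "B * B = C * C"
  shows "B * (B - C) = - ((B - C) * C)"
proof -
  have "B * (B - C) = B * B - B * C" using mult_minus_distrib_mat[OF assms(1,1,2)] .
  also have "\<dots> = - (B * C - C * C)" unfolding assms(3) using assms(1,2)
    by (intro eq_matI) auto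
  also have "B * C - C * C = (B - C) * C" using minus_mult_distrib_mat[OF assms(1,2,2)] ..
  finally show ?thesis .
qed

text \<open>With D = B - C, the hypothesis gives D B D + D C D = 0; both summands are psd, so both
  B D and C D vanish, hence D D = 0.\<close>

lemma psd_sqrt_unique:
  assumes B: "psd n B" and C: "psd n C" and eq: "B * B = C * C"
  shows "B = C"
proof -
  define D where "D = B - C"
  note c = psdD(1)[OF B] psdD(1)[OF C]
  have D: "D \<in> carrier_mat n n" using minus_carrier_mat[OF c(2)] by (simp add: D_def)
  have hD: "adj D = D" unfolding D_def using adj_minus[OF c] psdD(2)[OF B] psdD(2)[OF C] by simp
  have BD: "B * D = - (D * C)" unfolding D_def by (rule minus_mult_self_eq[OF c eq])
  have "Re (mtrace (D * B * D)) = - Re (mtrace (D * C * D))"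
  proof -
    have "D * B * D = - (D * (D * C))"
      using c D BD by (simp add: mat_assoc)
    moreover have "mtrace (- (D * (D * C))) = - mtrace (D * (D * C))"
      using D c by (simp add: mtrace_def sum_negf)
    moreover have "mtrace (D * (D * C)) = mtrace (D * C * D)"
      using D c by (intro mtrace_comm[of _ n n]) auto
    ultimately show ?thesis by simp
  qed
  moreover have "0 \<le> Re (mtrace (D * B * D))" "0 \<le> Re (mtrace (D * C * D))"
    using psd_trace_nonneg[OF psd_congruence[OF B D]] psd_trace_nonneg[OF psd_congruence[OF C D]] hD by auto
  ultimately have 0: "Re (mtrace (D * B * D)) = 0" "Re (mtrace (D * C * D)) = 0" by auto
  \<comment> \<open>With R a square root of X, the trace of D X D is the squared Hilbert-Schmidt
    norm of \<open>R * D\<close>; so \<open>R * D\<close> vanishes, and with it X D = R (R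
    D).\<close>
  have vanish: "X * D = 0\<^sub>m n n" if X: "psd n X" and X0: "Re (mtrace (D * X * D)) = 0" for X
  proof -
    from psd_sqrt_ex[OF X] obtain R where R: "psd n R" and RR: "R * R = X" by blast
    note cR = psdD[OF R]
    have "adj (R * D) * (R * D) = D * X * D"
      using cR D by (simp add: RR[symmetric] mat_assoc adj_mult_dim hD)
    then have RD: "R * D = 0\<^sub>m n n" using X0 gram_zero_imp_zero[of "R * D" n n] cR D by auto
    have "X * D = R * (R * D)" using cR D by (simp add: RR[symmetric] mat_assoc)
    then show ?thesis unfolding RD using cR by simp
  qed
  have "adj D * D = (B - C) * D" using hD by (simp add: D_def)
  also have "\<dots> = B * D - C * D" using c D by (simp add: minus_mult_distrib_dim)
  also have "\<dots> = 0\<^sub>m n n" unfolding vanish[OF B 0(1)] vanish[OF C 0(2)] by auto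
  finally have "D = 0\<^sub>m n n" using gram_zero_imp_zero[OF D] by (simp add: mtrace_def)
  then have D0: "D $$ (i,j) = 0" if "i < n" "j < n" for i j using that by simp
  show "B = C"
  proof (rule eq_matI)
    fix i j assume "i < dim_row C" "j < dim_col C"
    then have "i < n" "j < n" using c by auto
    with D0[of i j] show "B $$ (i,j) = C $$ (i,j)" using c by (auto simp: D_def)
  qed (use c in auto)
qed

text \<open>Existence and uniqueness together make the definite description in \<open>msqrt\<close>
  denote a root.\<close>

lemma msqrt:
  assumes A: "psd n A"
  shows "psd n (msqrt A)" and "msqrt A * msqrt A = A"
proof -
  have "\<exists>!B. psd (dim_row A) B \<and> B * B = A"
    using psd_sqrt_ex[OF A] psd_sqrt_unique psdD(1)[OF A] by (metis carrier_matD(1))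
  from theI'[OF this] show "psd n (msqrt A)" "msqrt A * msqrt A = A"
    using psdD(1)[OF A] by (auto simp: msqrt_def)
qed

lemma msqrt_eqI:
  assumes B: "psd n B" and "B * B = A"
  shows "msqrt A = B"
proof -
  have "psd n A" using psd_gram[OF psdD(1)[OF B]] assms psdD(2)[OF B] by simp
  then show ?thesis using psd_sqrt_unique[of n "msqrt A" B] msqrt[of n A] assms by metis
qed

section \<open>Trace norm and contractions\<close>

text \<open>Operator norm at most 1, in the form that the completeness condition of a POVM provides.\<close>

definition contraction :: "nat \<Rightarrow> nat \<Rightarrow> complex mat \<Rightarrow> bool" where
  "contraction m N U \<longleftrightarrow> U \<in> carrier_mat m N \<and> psd m (1\<^sub>m m - U * adj U)"

text \<open>Hence multiplying by a unitary on the right preserves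
  \<open>contraction\<close>.\<close>

lemma mult_unitary_self:
  assumes U: "U \<in> carrier_mat m N" and V: "V \<in> carrier_mat N N" "V * adj V = 1\<^sub>m N"
  shows "(U * V) * adj (U * V) = U * adj U"
proof -
  have "V * (adj V * adj U) = adj U" using U V by (intro mat_cancel[OF V(2)]) auto
  then show ?thesis using U V(1) by (simp add: mat_assoc adj_mult_dim)
qed

text \<open>Let x be column k of W and a = |x|^2. Testing the positivity of 1 - W W* at x gives |W*
  x|^2 \<le> a, while entry k of W* x is a itself. So a^2 \<le> a.\<close>

lemma contraction_column_le_1:
  assumes W: "contraction m N W" and k: "k < N"
  shows "(\<Sum>i<m. (cmod (W $$ (i,k)))\<^sup>2) \<le> 1"
proof -
  have Wc: "W \<in> carrier_mat m N" using W by (simp add: contraction_def)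
  note aW = adj_carrier[OF Wc]
  define X where "X = mat m 1 (\<lambda>(i,_). W $$ (i,k))"
  define a where "a = (\<Sum>i<m. (cmod (W $$ (i,k)))\<^sup>2)"
  have X: "X \<in> carrier_mat m 1" by (simp add: X_def)
  have a0: "0 \<le> a" by (auto simp: a_def intro: sum_nonneg)
  have XX: "Re (mtrace (adj X * X)) = a" 
    unfolding Re_mtrace_gram_self[OF X] by (simp add: X_def a_def)
  have WX: "adj W * X \<in> carrier_mat N 1" using aW X by simp
  have "0 \<le> Re (mtrace (adj X * ((1\<^sub>m m - W * adj W) * X)))"
    using W X unfolding contraction_def psd_iff by simp
  also have "adj X * ((1\<^sub>m m - W * adj W) * X) = adj X * X - adj (adj W * X) * (adj W * X)"
    using X Wc by (simp add: minus_mult_distrib_dim mult_minus_distrib_dim mat_assoc adj_mult_dim)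
  also have "Re (mtrace \<dots>) = a - Re (mtrace (adj (adj W * X) * (adj W * X)))"
    using XX X aW by (simp add: mtrace_def sum_subtractf del: index_mult_mat(1))
  finally have 1: "Re (mtrace (adj (adj W * X) * (adj W * X))) \<le> a" by simp
  have "(\<Sum>j<N. (cmod ((adj W * X) $$ (j,0)))\<^sup>2) \<le> a"
    using 1 unfolding Re_mtrace_gram_self[OF WX] by simp
  moreover have "(cmod ((adj W * X) $$ (k,0)))\<^sup>2 \<le> (\<Sum>j<N. (cmod ((adj W * X) $$ (j,0)))\<^sup>2)"
    using k by (intro member_le_sum) auto
  moreover have "(adj W * X) $$ (k,0) = complex_of_real a"
    using k Wc unfolding a_def of_real_sum complex_norm_square
    by (subst index_mult[OF aW X k]) (auto simp: X_def mult.commute)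
  ultimately have "a\<^sup>2 \<le> a" by simp
  then have "a * a \<le> 1 * a" by (simp add: power2_eq_square)
  then have "a \<le> 1" using a0 by (cases "a = 0") (auto simp: mult_le_cancel_right)
  then show ?thesis by (simp add: a_def)
qed

text \<open>Both halves of the duality between trace norm and operator norm come from diagonalizing
  adj Y * Y by a unitary V: the columns of Y * V are then orthogonal, with norms the singular values
  of Y.\<close>

lemma gram_diagonalization:
  assumes Y: "Y \<in> carrier_mat m N"
  obtains V d where "V \<in> carrier_mat N N" "adj V * V = 1\<^sub>m N" "V * adj V = 1\<^sub>m N" "\<forall>i<N. 0 \<le> d i"
    "adj (Y * V) * (Y * V) = dg N (\<lambda>i. d i * d i)" "msqrt (adj Y * Y) = V * dg N d * adj V"
proof -
  note p = psd_gram[OF Y]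
  from psd_diagonalization[OF msqrt(1)[OF p]] obtain V d where V: "V \<in> carrier_mat N N"
    and VV: "adj V * V = 1\<^sub>m N" "V * adj V = 1\<^sub>m N" and d: "\<forall>i<N. 0 \<le> d i" 
    and eq: "msqrt (adj Y * Y) = V * dg N d * adj V" by blast
  note c = V adj_carrier[OF V] Y adj_carrier[OF Y] dg_carrier[of N "\<lambda>i. d i * d i"]
  have g: "adj Y * Y = V * dg N (\<lambda>i. d i * d i) * adj V"
    using msqrt(2)[OF p] unfolding eq unitary_conj_dg(1)[OF V VV(1)] by simp
  note dim = carrier_matD[OF V] carrier_matD[OF Y]
  have "adj (Y * V) * (Y * V) = adj V * (adj Y * Y) * V"
    by (simp add: dim mat_assoc adj_mult_dim)
  also have "\<dots> = dg N (\<lambda>i. d i * d i)"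
    unfolding g by (simp add: dim mat_assoc mat_cancel[OF VV(1)] VV(1))
  finally show ?thesis using that V VV d eq by blast
qed

text \<open>After the change of basis V the trace is a sum over k of inner products of column k of W
  = U V with column k of Z = Y V. The first has norm at most 1 and the second has norm
  \<open>d k\<close>, and the \<open>d k\<close> add up to the trace norm.\<close>

lemma trace_norm_upper:
  assumes Y: "Y \<in> carrier_mat m N" and U: "contraction m N U"
  shows "Re (mtrace (adj U * Y)) \<le> Re (mtrace (msqrt (adj Y * Y)))"
proof -
  have Uc: "U \<in> carrier_mat m N" using U by (simp add: contraction_def)
  obtain V d where V: "V \<in> carrier_mat N N" and VV: "adj V * V = 1\<^sub>m N" "V * adj V = 1\<^sub>m N" 
    and d: "\<forall>i<N. 0 \<le> d i" and g: "adj (Y * V) * (Y * V) = dg N (\<lambda>i. d i * d i)"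
    and sq: "msqrt (adj Y * Y) = V * dg N d * adj V"
    using gram_diagonalization[OF Y] by blast
  define Z where "Z = Y * V"
  define W where "W = U * V"
  have Z: "Z \<in> carrier_mat m N" and Wc: "W \<in> carrier_mat m N" using Y Uc V by (auto simp: Z_def W_def)
  have W: "contraction m N W" using U Wc unfolding contraction_def W_def mult_unitary_self[OF Uc V VV(2)] by simp
  have Zk: "(\<Sum>i<m. (cmod (Z $$ (i,k)))\<^sup>2) = (d k)\<^sup>2" if k: "k < N" for k
  proof -
    have "complex_of_real (\<Sum>i<m. (cmod (Z $$ (i,k)))\<^sup>2) = (adj Z * Z) $$ (k,k)"
      unfolding of_real_sum complex_norm_square index_mult[OF adj_carrier[OF Z] Z k k]
      using Z k by (auto simp: mult.commute)
    also have "\<dots> = complex_of_real ((d k)\<^sup>2)" unfolding Z_def g using k by (simp add: power2_eq_square)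
    finally show ?thesis using of_real_eq_iff by blast
  qed
  have col: "Re (\<Sum>i<m. cnj (W $$ (i,k)) * Z $$ (i,k)) \<le> d k" if k: "k < N" for k
  proof -
    have "Re (\<Sum>i<m. cnj (W $$ (i,k)) * Z $$ (i,k)) \<le> cmod (\<Sum>i<m. cnj (W $$ (i,k)) * Z $$ (i,k))"
      by (rule complex_Re_le_cmod)
    also have "\<dots> \<le> (\<Sum>i<m. cmod (W $$ (i,k)) * cmod (Z $$ (i,k)))"
      by (rule order_trans[OF norm_sum]) (simp add: norm_mult)
    finally have 1: "Re (\<Sum>i<m. cnj (W $$ (i,k)) * Z $$ (i,k)) \<le> (\<Sum>i<m. cmod (W $$ (i,k)) * cmod (Z $$ (i,k)))" .
    have "(\<Sum>i<m. cmod (W $$ (i,k)) * cmod (Z $$ (i,k)))\<^sup>2 \<le> 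
        (\<Sum>i<m. (cmod (W $$ (i,k)))\<^sup>2) * (\<Sum>i<m. (cmod (Z $$ (i,k)))\<^sup>2)"
      by (rule Cauchy_Schwarz_ineq_sum)
    also have "\<dots> \<le> 1 * (d k)\<^sup>2" unfolding Zk[OF k]
      by (rule mult_right_mono[OF contraction_column_le_1[OF W k]]) simp
    finally have "(\<Sum>i<m. cmod (W $$ (i,k)) * cmod (Z $$ (i,k)))\<^sup>2 \<le> (d k)\<^sup>2" by simp
    then have "(\<Sum>i<m. cmod (W $$ (i,k)) * cmod (Z $$ (i,k))) \<le> d k"
      by (rule power2_le_imp_le) (use d k in simp)
    with 1 show ?thesis by simp
  qed
  have "mtrace (adj U * Y) = mtrace (adj W * Z)"
  proof -
    note c = V adj_carrier[OF V] Y Uc adj_carrier[OF Uc]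
    have "mtrace (adj W * Z) = mtrace (adj V * (adj U * Y * V))"
      unfolding W_def Z_def using c by (simp add: mat_assoc adj_mult_dim)
    also have "\<dots> = mtrace (adj U * Y * V * adj V)"
      using c by (intro mtrace_comm[of _ N N]) auto
    also have "adj U * Y * V * adj V = adj U * Y"
      using c by (simp add: mat_assoc VV)
    finally show ?thesis by simp
  qed
  also have "Re \<dots> = (\<Sum>k<N. Re (\<Sum>i<m. cnj (W $$ (i,k)) * Z $$ (i,k)))"
    unfolding mtrace_gram[OF Wc Z] by simp
  also have "\<dots> \<le> (\<Sum>k<N. d k)" by (intro sum_mono col) simp
  also have "\<dots> = Re (mtrace (msqrt (adj Y * Y)))" unfolding sq unitary_conj_dg(3)[OF V VV(1)] by simp
  finally show ?thesis .
qed

text \<open>Normalizing the nonzero columns of Z = Y V, which are orthogonal, gives a partial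
  isometry W with W* Z = diag(d), and U = W V* undoes the change of basis. As Y may be rectangular
  or rank deficient, U is in general only a contraction.\<close>

lemma polar_decomposition:
  assumes Y: "Y \<in> carrier_mat m N"
  obtains U where "contraction m N U" "adj U * Y = msqrt (adj Y * Y)"
proof -
  obtain V d where V: "V \<in> carrier_mat N N" and VV: "adj V * V = 1\<^sub>m N" "V * adj V = 1\<^sub>m N" 
    and d: "\<forall>i<N. 0 \<le> d i" and g: "adj (Y * V) * (Y * V) = dg N (\<lambda>i. d i * d i)"
    and sq: "msqrt (adj Y * Y) = V * dg N d * adj V"
    using gram_diagonalization[OF Y] by blast
  define Z where "Z = Y * V"
  have Z: "Z \<in> carrier_mat m N" using Y V by (simp add: Z_def)
  \<comment> \<open>The value 0 at a vanishing singular value makes the corresponding column of W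
    zero; e marks the columns that survive.\<close>
  define r where "r k = (if d k = 0 then 0 else 1 / d k)" for k
  define e where "e k = (if d k = 0 then 0 else 1 :: real)" for k
  define W where "W = Z * dg N r"
  have W: "W \<in> carrier_mat m N" using Z unfolding W_def by (rule mult_carrier_mat) simp
  note c = Z adj_carrier[OF Z] V adj_carrier[OF V] Y adj_carrier[OF Y] W adj_carrier[OF W] dg_carrier
  have aW: "adj W = dg N r * adj Z" unfolding W_def using adj_mult[OF Z dg_carrier] by simp
  have "adj W * Z = dg N r * (adj Z * Z)"
    unfolding aW using c by (simp add: mat_assoc)
  also have "\<dots> = dg N (\<lambda>k. r k * (d k * d k))" unfolding Z_def g dg_mult ..
  also have "(\<lambda>k. r k * (d k * d k)) = d" by (auto simp: r_def fun_eq_iff)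
  finally have WZ: "adj W * Z = dg N d" .
  have "adj W * W = (adj W * Z) * dg N r" unfolding W_def using c by (simp add: mat_assoc adj_mult_dim)
  also have "\<dots> = dg N e" unfolding WZ dg_mult by (rule arg_cong[of _ _ "dg N"]) (auto simp: r_def e_def fun_eq_iff)
  finally have WW: "adj W * W = dg N e" .
  \<comment> \<open>The columns that e erases are zero already. This makes G = W W*
    idempotent.\<close>
  have We: "W * dg N e = W"
  proof -
    have "W * dg N e = Z * (dg N r * dg N e)" unfolding W_def using c by (simp add: mat_assoc)
    also have "dg N r * dg N e = dg N r" unfolding dg_mult by (rule arg_cong[of _ _ "dg N"]) (auto simp: r_def e_def fun_eq_iff)
    finally show ?thesis by (simp add: W_def)
  qed
  define G where "G = W * adj W"
  have G: "G \<in> carrier_mat m m" unfolding G_def using c by simp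
  have hG: "adj G = G" unfolding G_def using adj_mult[OF W adj_carrier[OF W]] by simp
  have "G * G = W * (adj W * W) * adj W" unfolding G_def using c by (simp add: mat_assoc)
  then have GG: "G * G = G" unfolding WW We G_def .
  \<comment> \<open>As G is an orthogonal projection, so is 1 - G, which therefore equals its own
    Gram matrix and is psd.\<close>
  have "adj (1\<^sub>m m - G) * (1\<^sub>m m - G) = (1\<^sub>m m - G) * (1\<^sub>m m - G)"
    using adj_minus[of "1\<^sub>m m" m m G] G hG by simp
  also have "\<dots> = (1\<^sub>m m - G) - G * (1\<^sub>m m - G)" using G by (simp add: minus_mult_distrib_dim)
  also have "G * (1\<^sub>m m - G) = G - G" using G GG by (simp add: mult_minus_distrib_dim)
  also have "1\<^sub>m m - G - (G - G) = 1\<^sub>m m - G" using G by (intro eq_matI) auto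
  finally have 1: "psd m (1\<^sub>m m - G)" using psd_gram[OF minus_carrier_mat[OF G, of "1\<^sub>m m"]] by simp
  define U where "U = W * adj V"
  have "U * adj U = G" unfolding U_def G_def using VV c by (intro mult_unitary_self) auto
  with 1 have "contraction m N U" using c by (simp add: contraction_def U_def)
  moreover have "adj U * Y = msqrt (adj Y * Y)"
  proof -
    have "adj U * Y = V * (adj W * (Y * (V * adj V)))"
      unfolding VV U_def using c by (simp add: mat_assoc adj_mult_dim)
    also have "\<dots> = V * (adj W * Z) * adj V" unfolding Z_def using c by (simp add: mat_assoc)
    finally show ?thesis unfolding WZ sq .
  qed
  ultimately show ?thesis using that by blast
qed

section \<open>Block matrices\<close>

lemma block_index:
  fixes r n m :: nat
  assumes "r < n * m" shows "r div m < n" "r mod m < m"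
proof -
  have "0 < m" using assms by (cases m) auto
  then show "r mod m < m" by simp
  show "r div m < n" using assms by (rule less_mult_imp_div_less)
qed

lemma block_index_less:
  fixes i n b m :: nat
  shows "i < n \<Longrightarrow> b < m \<Longrightarrow> i * m + b < n * m"
proof -
  assume "i < n" "b < m"
  then have "i * m + b < Suc i * m" by simp
  also have "\<dots> \<le> n * m" using \<open>i < n\<close> by (intro mult_right_mono) auto
  finally show ?thesis .
qed

text \<open>Division with remainder is a bijection between the flat indices r = i * m + b and the
  pairs (i,b).\<close>

lemma sum_block:
  fixes f :: "nat \<Rightarrow> nat \<Rightarrow> 'a :: comm_monoid_add"
  shows "(\<Sum>r<n*m. f (r div m) (r mod m)) = (\<Sum>i<n. \<Sum>b<m. f i b)"
  unfolding sum.cartesian_product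
  by (rule sum.reindex_bij_witness[of _ "\<lambda>(i,b). i * m + b" "\<lambda>r. (r div m, r mod m)"])
    (auto simp: block_index block_index_less)

text \<open>The block row \<open>(K 0, ..., K (n-1))\<close>, with columns numbered by the flat
  index of \<open>qsd_state\<close>.\<close>

definition hcat :: "nat \<Rightarrow> nat \<Rightarrow> (nat \<Rightarrow> complex mat) \<Rightarrow> complex mat" where
  "hcat n m K = mat m (n*m) (\<lambda>(a,r). K (r div m) $$ (a, r mod m))"

definition bdiag :: "nat \<Rightarrow> nat \<Rightarrow> (nat \<Rightarrow> complex mat) \<Rightarrow> complex mat" where
  "bdiag n m K = mat (n*m) (n*m) (\<lambda>(r,c). if r div m = c div m then K (r div m) $$ (r mod m, c mod m) else 0)"

lemma hcat_carrier [simp]: "hcat n m K \<in> carrier_mat m (n*m)"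
  and bdiag_carrier [simp]: "bdiag n m K \<in> carrier_mat (n*m) (n*m)"
  by (auto simp: hcat_def bdiag_def)

lemma hcat_dim [simp]: "dim_row (hcat n m K) = m" "dim_col (hcat n m K) = n*m"
  and bdiag_dim [simp]: "dim_row (bdiag n m K) = n*m" "dim_col (bdiag n m K) = n*m"
  by (auto simp: hcat_def bdiag_def)

lemma hcat_index [simp]:
  "a < m \<Longrightarrow> r < n * m \<Longrightarrow> hcat n m K $$ (a,r) = K (r div m) $$ (a, r mod m)"
  by (simp add: hcat_def)

lemma bdiag_index [simp]:
  "r < n * m \<Longrightarrow> c < n * m \<Longrightarrow> bdiag n m K $$ (r,c) =
     (if r div m = c div m then K (r div m) $$ (r mod m, c mod m) else 0)"
  by (simp add: bdiag_def)

lemma bdiag_cong: "(\<And>i. i < n \<Longrightarrow> K i = L i) \<Longrightarrow> bdiag n m K = bdiag n m L"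
  by (rule eq_matI) (auto simp: block_index)

text \<open>A block row times a block column is the sum of the blockwise products. The entrywise
  form fits the completeness condition in \<open>povm\<close>.\<close>

lemma hcat_mult_adj_hcat:
  assumes K: "\<And>i. i < n \<Longrightarrow> K i \<in> carrier_mat m m" and L: "\<And>i. i < n \<Longrightarrow> L i \<in> carrier_mat m m"
    and ab: "a < m" "b < m"
  shows "(hcat n m K * adj (hcat n m L)) $$ (a,b) = (\<Sum>i<n. (K i * adj (L i)) $$ (a,b))"
proof -
  have "(hcat n m K * adj (hcat n m L)) $$ (a,b)
      = (\<Sum>r<n*m. K (r div m) $$ (a, r mod m) * cnj (L (r div m) $$ (b, r mod m)))"
    using ab by (subst index_mult[of _ m "n*m" _ m]) auto
  also have "\<dots> = (\<Sum>i<n. \<Sum>c<m. K i $$ (a,c) * cnj (L i $$ (b,c)))"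
    by (rule sum_block)
  also have "\<dots> = (\<Sum>i<n. (K i * adj (L i)) $$ (a,b))"
  proof (rule sum.cong[OF refl])
    fix i assume "i \<in> {..<n}"
    then have c: "K i \<in> carrier_mat m m" "L i \<in> carrier_mat m m" using K L by auto
    show "(\<Sum>c<m. K i $$ (a,c) * cnj (L i $$ (b,c))) = (K i * adj (L i)) $$ (a,b)"
      unfolding index_mult[OF c(1) adj_carrier[OF c(2)] ab] using c ab by (intro sum.cong) auto
  qed
  finally show ?thesis .
qed

lemma mtrace_adj_hcat_mult_hcat:
  assumes K: "\<And>i. i < n \<Longrightarrow> K i \<in> carrier_mat m m" and L: "\<And>i. i < n \<Longrightarrow> L i \<in> carrier_mat m m"
  shows "mtrace (adj (hcat n m K) * hcat n m L) = (\<Sum>i<n. mtrace (adj (K i) * L i))"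
proof -
  have "mtrace (adj (hcat n m K) * hcat n m L) 
      = (\<Sum>r<n*m. \<Sum>a<m. cnj (K (r div m) $$ (a, r mod m)) * L (r div m) $$ (a, r mod m))"
    by (subst mtrace_gram[of _ m "n*m"]) auto
  also have "\<dots> = (\<Sum>i<n. \<Sum>b<m. \<Sum>a<m. cnj (K i $$ (a,b)) * L i $$ (a,b))"
    by (rule sum_block[of "\<lambda>i b. \<Sum>a<m. cnj (K i $$ (a,b)) * L i $$ (a,b)"])
  also have "\<dots> = (\<Sum>i<n. mtrace (adj (K i) * L i))"
    by (intro sum.cong refl mtrace_gram[symmetric] K L) auto
  finally show ?thesis .
qed

lemma hcat_mult_bdiag:
  assumes K: "\<And>i. i < n \<Longrightarrow> K i \<in> carrier_mat m m" and L: "\<And>i. i < n \<Longrightarrow> L i \<in> carrier_mat m m"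
  shows "hcat n m K * bdiag n m L = hcat n m (\<lambda>i. K i * L i)"
proof (rule eq_matI)
  fix a c assume "a < dim_row (hcat n m (\<lambda>i. K i * L i))" "c < dim_col (hcat n m (\<lambda>i. K i * L i))"
  then have a: "a < m" and c: "c < n * m" by auto
  let ?j = "c div m" let ?b = "c mod m"
  have j: "?j < n" "?b < m" using c by (auto simp: block_index)
  have "(hcat n m K * bdiag n m L) $$ (a,c)
      = (\<Sum>r<n*m. K (r div m) $$ (a, r mod m) * (if r div m = ?j then L (r div m) $$ (r mod m, ?b) else 0))"
    using a c by (subst index_mult[of _ m "n*m" _ "n*m"]) auto
  also have "\<dots> = (\<Sum>i<n. \<Sum>b<m. K i $$ (a,b) * (if i = ?j then L i $$ (b, ?b) else 0))"
    by (rule sum_block)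
  also have "\<dots> = (\<Sum>i<n. if i = ?j then \<Sum>b<m. K i $$ (a,b) * L i $$ (b, ?b) else 0)"
    by (intro sum.cong) auto
  also have "\<dots> = (K ?j * L ?j) $$ (a,?b)"
    using j by (simp add: index_mult[OF K[OF j(1)] L[OF j(1)] a j(2)] del: index_mult_mat(1))
  finally show "(hcat n m K * bdiag n m L) $$ (a,c) = hcat n m (\<lambda>i. K i * L i) $$ (a,c)"
    using a c by simp
qed auto

lemma bdiag_mult:
  assumes K: "\<And>i. i < n \<Longrightarrow> K i \<in> carrier_mat m m" and L: "\<And>i. i < n \<Longrightarrow> L i \<in> carrier_mat m m"
  shows "bdiag n m K * bdiag n m L = bdiag n m (\<lambda>i. K i * L i)"
proof (rule eq_matI)
  fix r c assume "r < dim_row (bdiag n m (\<lambda>i. K i * L i))" "c < dim_col (bdiag n m (\<lambda>i. K i * L i))"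
  then have r: "r < n * m" and c: "c < n * m" by auto
  let ?i = "r div m" let ?a = "r mod m" let ?j = "c div m" let ?b = "c mod m"
  have j: "?j < n" "?b < m" "?i < n" "?a < m" using r c by (auto simp: block_index)
  have "(bdiag n m K * bdiag n m L) $$ (r,c)
      = (\<Sum>s<n*m. (if ?i = s div m then K ?i $$ (?a, s mod m) else 0) * 
          (if s div m = ?j then L (s div m) $$ (s mod m, ?b) else 0))"
    using r c by (subst index_mult[of _ "n*m" "n*m" _ "n*m"]) auto
  also have "\<dots> = (\<Sum>k<n. \<Sum>b<m. (if ?i = k then K ?i $$ (?a,b) else 0) * (if k = ?j then L k $$ (b, ?b) else 0))"
    by (rule sum_block)
  also have "\<dots> = (\<Sum>k<n. if k = ?i then (if ?i = ?j then \<Sum>b<m. K ?i $$ (?a,b) * L ?i $$ (b, ?b) else 0) else 0)"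
    by (intro sum.cong) auto
  also have "\<dots> = (if ?i = ?j then (K ?i * L ?i) $$ (?a,?b) else 0)"
    using j(3) unfolding index_mult[OF K[OF j(3)] L[OF j(3)] j(4) j(2)] by simp
  finally show "(bdiag n m K * bdiag n m L) $$ (r,c) = bdiag n m (\<lambda>i. K i * L i) $$ (r,c)"
    using r c by (simp only: bdiag_index)
qed auto

lemma adj_bdiag:
  assumes K: "\<And>i. i < n \<Longrightarrow> K i \<in> carrier_mat m m"
  shows "adj (bdiag n m K) = bdiag n m (\<lambda>i. adj (K i))"
proof (rule eq_matI)
  fix r c assume "r < dim_row (bdiag n m (\<lambda>i. adj (K i)))" "c < dim_col (bdiag n m (\<lambda>i. adj (K i)))"
  then have r: "r < n * m" and c: "c < n * m" by auto
  have "dim_row (K (r div m)) = m" "dim_col (K (r div m)) = m"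
    using K[of "r div m"] block_index[OF r] by auto
  then show "adj (bdiag n m K) $$ (r,c) = bdiag n m (\<lambda>i. adj (K i)) $$ (r,c)"
    using r c block_index[OF r] block_index[OF c] by auto
qed auto

text \<open>The square roots of the blocks form a block diagonal matrix whose Gram matrix is the
  given one.\<close>

lemma psd_bdiag:
  assumes K: "\<And>i. i < n \<Longrightarrow> psd m (K i)"
  shows "psd (n*m) (bdiag n m K)"
proof -
  let ?R = "\<lambda>i. msqrt (K i)"
  have R: "?R i \<in> carrier_mat m m" "adj (?R i) = ?R i" "?R i * ?R i = K i" if "i < n" for i
    using msqrt[OF K[OF that]] by (auto dest: psdD)
  have "adj (bdiag n m ?R) * bdiag n m ?R = bdiag n m (\<lambda>i. adj (?R i) * ?R i)"
    using R by (simp add: adj_bdiag bdiag_mult)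
  also have "\<dots> = bdiag n m K" using R by (intro bdiag_cong) auto
  finally show ?thesis using psd_gram[OF bdiag_carrier[of n m ?R]] by simp
qed

lemma hcat_blocks:
  assumes "U \<in> carrier_mat m (n*m)"
  shows "U = hcat n m (\<lambda>i. mat m m (\<lambda>(a,b). U $$ (a, i * m + b)))"
  using assms by (intro eq_matI) (auto simp: block_index)

text \<open>The (i,j)-block of T* T is \<open>adj (A i) * A j\<close>, where \<open>A i\<close> is
  the square root in block i of T, and these roots are self-adjoint.\<close>

lemma qsd_state_eq_gram:
  assumes A: "\<And>i. i < n \<Longrightarrow> psd m (complex_of_real (\<eta> i) \<cdot>\<^sub>m \<rho> i)"
  defines "T \<equiv> hcat n m (\<lambda>i. msqrt (complex_of_real (\<eta> i) \<cdot>\<^sub>m \<rho> i))"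
  shows "qsd_state n m \<eta> \<rho> = adj T * T"
proof (rule eq_matI)
  let ?A = "\<lambda>i. msqrt (complex_of_real (\<eta> i) \<cdot>\<^sub>m \<rho> i)"
  fix r c assume "r < dim_row (adj T * T)" "c < dim_col (adj T * T)"
  then have r: "r < n * m" and c: "c < n * m" by (auto simp: T_def)
  note br = block_index[OF r] and bc = block_index[OF c]
  have Ar: "?A (r div m) \<in> carrier_mat m m" "adj (?A (r div m)) = ?A (r div m)" 
    and Ac: "?A (c div m) \<in> carrier_mat m m"
    using msqrt(1)[OF A[OF br(1)]] msqrt(1)[OF A[OF bc(1)]] by (auto dest: psdD)
  have "(adj T * T) $$ (r,c) = (\<Sum>a<m. cnj (?A (r div m) $$ (a, r mod m)) * ?A (c div m) $$ (a, c mod m))"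
    using r c unfolding T_def by (subst index_mult[of _ "n*m" m _ "n*m"]) auto
  also have "\<dots> = (adj (?A (r div m)) * ?A (c div m)) $$ (r mod m, c mod m)"
    unfolding index_mult[OF adj_carrier[OF Ar(1)] Ac br(2) bc(2)]
    using Ar(1) br by (intro sum.cong) auto
  also have "\<dots> = qsd_state n m \<eta> \<rho> $$ (r,c)" unfolding Ar(2) using r c by (simp add: qsd_state_def)
  finally show "qsd_state n m \<eta> \<rho> $$ (r,c) = (adj T * T) $$ (r,c)" ..
qed (auto simp: qsd_state_def T_def)

section \<open>Partial incoherent states as block diagonal psd matrices of trace one\<close>

lemma psd_zero: "psd m (0\<^sub>m m m)"
  using psd_gram[of "0\<^sub>m m m" m m] by simp

lemma psd_trace_zero_imp_zero:
  assumes A: "psd m A" and 0: "Re (mtrace A) = 0"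
  shows "A = 0\<^sub>m m m"
proof -
  note s = msqrt[OF A] and p = psdD[OF msqrt(1)[OF A]]
  have "adj (msqrt A) * msqrt A = A" using s p by simp
  then have "msqrt A = 0\<^sub>m m m" using gram_zero_imp_zero[OF p(1)] 0 by simp
  then show ?thesis using s(2) by simp
qed

lemma psd_mtrace_real:
  assumes A: "psd m A" shows "mtrace A = complex_of_real (Re (mtrace A))"
proof -
  note c = psdD[OF A]
  have "mtrace (adj A) = cnj (mtrace A)" using c(1) by (simp add: mtrace_def)
  then show ?thesis unfolding c(2) by (simp add: complex_eq_iff)
qed

text \<open>The weights are absorbed into the blocks by X_i = p_i \<tau>_i; conversely, p_i is the
  trace of X_i and \<tau>_i the normalized block.\<close>

lemma partial_incoherent_eq:
  assumes \<delta>: "density m \<delta>"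
  shows "partial_incoherent n m = {bdiag n m X |X. (\<forall>i<n. psd m (X i)) \<and> (\<Sum>i<n. Re (mtrace (X i))) = 1}"
proof (intro equalityI subsetI)
  fix \<sigma> assume "\<sigma> \<in> partial_incoherent n m"
  then obtain p \<tau> where p: "\<forall>i<n. 0 \<le> p i" "(\<Sum>i<n. p i) = (1::real)" and \<tau>: "\<forall>i<n. density m (\<tau> i)"
    and \<sigma>: "\<sigma> = mat (n*m) (n*m) (\<lambda>(r,c). if r div m = c div m
            then complex_of_real (p (r div m)) * \<tau> (r div m) $$ (r mod m, c mod m) else 0)"
    unfolding partial_incoherent_def by blast
  let ?X = "\<lambda>i. complex_of_real (p i) \<cdot>\<^sub>m \<tau> i"
  have c: "\<tau> i \<in> carrier_mat m m" if "i < n" for i using \<tau> that by (auto simp: density_def psd_def)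
  have "\<sigma> = bdiag n m ?X"
    unfolding \<sigma>
  proof (rule eq_matI)
    fix r c assume "r < dim_row (bdiag n m ?X)" "c < dim_col (bdiag n m ?X)"
    then have r: "r < n * m" and c': "c < n * m" by auto
    show "mat (n*m) (n*m) (\<lambda>(r,c). if r div m = c div m
            then complex_of_real (p (r div m)) * \<tau> (r div m) $$ (r mod m, c mod m) else 0) $$ (r,c) = bdiag n m ?X $$ (r,c)"
      using r c' block_index[OF r] block_index[OF c'] carrier_matD[OF c[of "c div m"]] by simp
  qed auto
  moreover have "\<forall>i<n. psd m (?X i)" using p \<tau> by (auto intro: psd_smult simp: density_def)
  moreover have "(\<Sum>i<n. Re (mtrace (?X i))) = 1"
    using p(2) \<tau> c by (simp add: mtrace_smult[of _ m] density_def)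
  ultimately show "\<sigma> \<in> {bdiag n m X |X. (\<forall>i<n. psd m (X i)) \<and> (\<Sum>i<n. Re (mtrace (X i))) = 1}" by blast
next
  fix \<sigma> assume "\<sigma> \<in> {bdiag n m X |X. (\<forall>i<n. psd m (X i)) \<and> (\<Sum>i<n. Re (mtrace (X i))) = 1}"
  then obtain X where X: "\<forall>i<n. psd m (X i)" "(\<Sum>i<n. Re (mtrace (X i))) = 1" and \<sigma>: "\<sigma> = bdiag n m X" by blast
  define p where "p i = Re (mtrace (X i))" for i
  \<comment> \<open>A block of trace 0 is the zero matrix and cannot be normalized; any density
    matrix may stand in for it, and \<delta> is supplied for that case.\<close>
  define \<tau> where "\<tau> i = (if p i = 0 then \<delta> else complex_of_real (1 / p i) \<cdot>\<^sub>m X i)" for i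
  have p0: "0 \<le> p i" if "i < n" for i using X that psd_trace_nonneg[of m "X i"] by (simp add: p_def)
  have c: "X i \<in> carrier_mat m m" if "i < n" for i using X that psdD(1) by blast
  have \<tau>: "density m (\<tau> i)" if i: "i < n" for i
  proof (cases "p i = 0")
    case False
    then have "mtrace (\<tau> i) = complex_of_real (1 / p i) * complex_of_real (p i)"
      using psd_mtrace_real[of m "X i"] X i unfolding p_def by (simp add: \<tau>_def p_def mtrace_smult[OF c[OF i]])
    then have "mtrace (\<tau> i) = 1" using False by simp
    moreover have "psd m (\<tau> i)" using False p0[OF i] X i by (auto simp: \<tau>_def simp del: of_real_divide intro!: psd_smult)
    ultimately show ?thesis by (simp add: density_def)
  qed (simp add: \<tau>_def \<delta>)
  have X\<tau>: "complex_of_real (p i) * \<tau> i $$ (a,b) = X i $$ (a,b)" if "i < n" "a < m" "b < m" for i a b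
  proof (cases "p i = 0")
    case True
    then have "X i = 0\<^sub>m m m" using X that psd_trace_zero_imp_zero[of m "X i"] by (simp add: p_def)
    then show ?thesis using True that by simp
  next
    case False
    then show ?thesis using that carrier_matD[OF c[OF that(1)]] by (simp add: \<tau>_def)
  qed
  have "\<sigma> = mat (n*m) (n*m) (\<lambda>(r,c). if r div m = c div m
            then complex_of_real (p (r div m)) * \<tau> (r div m) $$ (r mod m, c mod m) else 0)"
    unfolding \<sigma> by (rule eq_matI) (auto simp: X\<tau> block_index)
  then show "\<sigma> \<in> partial_incoherent n m" 
    unfolding partial_incoherent_def using p0 \<tau> X(2) unfolding p_def[symmetric] by blast
qed

section \<open>Minimum error probability and coherence\<close>

text \<open>With T the block row of the \<open>A i\<close> and S = \<open>bdiag n m B\<close>, the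
  root of S S is S, and S (T* T) S = (T S)* (T S) where T S = Y. So the fidelity is the trace norm
  of Y.\<close>

lemma fidelity_gram_bdiag:
  assumes A: "\<And>i. i < n \<Longrightarrow> A i \<in> carrier_mat m m" and B: "\<And>i. i < n \<Longrightarrow> psd m (B i)"
  defines "Y \<equiv> hcat n m (\<lambda>i. A i * B i)"
  shows "fidelity (adj (hcat n m A) * hcat n m A) (bdiag n m (\<lambda>i. B i * B i)) = Re (mtrace (msqrt (adj Y * Y)))"
proof -
  have Bc: "B i \<in> carrier_mat m m" if "i < n" for i using B[OF that] psdD by blast
  have pB: "psd (n*m) (bdiag n m B)" using B by (rule psd_bdiag)
  have "msqrt (bdiag n m (\<lambda>i. B i * B i)) = bdiag n m B"
    using Bc by (intro msqrt_eqI[OF pB] bdiag_mult)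
  moreover have "Y = hcat n m A * bdiag n m B" unfolding Y_def using A Bc by (rule hcat_mult_bdiag[symmetric])
  ultimately show ?thesis
    unfolding fidelity_def using psdD(2)[OF pB] by (simp add: adj_mult_dim mat_assoc)
qed

text \<open>The polar factor U of Y attains the trace norm, so the fidelity is a single inner
  product to which Cauchy-Schwarz applies; the measurement is read off from the blocks of U.\<close>

lemma fidelity_square_le_success:
  assumes n: "0 < n" and \<rho>: "\<And>i. i < n \<Longrightarrow> psd m (\<rho> i)" and \<eta>: "\<And>i. i < n \<Longrightarrow> 0 \<le> \<eta> i"
    and A: "\<And>i. i < n \<Longrightarrow> psd m (A i)" and AA: "\<And>i. i < n \<Longrightarrow> A i * A i = complex_of_real (\<eta> i) \<cdot>\<^sub>m \<rho> i"
    and B: "\<And>i. i < n \<Longrightarrow> psd m (B i)" and BB: "(\<Sum>i<n. Re (mtrace (B i * B i))) = 1"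
  shows "\<exists>M. povm n m M \<and> 
    (fidelity (adj (hcat n m A) * hcat n m A) (bdiag n m (\<lambda>i. B i * B i)))\<^sup>2 \<le> success_prob n \<eta> \<rho> M"
proof -
  define Y where "Y = hcat n m (\<lambda>i. A i * B i)"
  have Ac: "A i \<in> carrier_mat m m" "adj (A i) = A i" if "i < n" for i using A[OF that] psdD by blast+
  have Bc: "B i \<in> carrier_mat m m" "adj (B i) = B i" if "i < n" for i using B[OF that] psdD by blast+
  have \<rho>c: "\<rho> i \<in> carrier_mat m m" if "i < n" for i using \<rho>[OF that] psdD by blast
  have F: "fidelity (adj (hcat n m A) * hcat n m A) (bdiag n m (\<lambda>i. B i * B i)) = Re (mtrace (msqrt (adj Y * Y)))"
    unfolding Y_def using Ac B by (intro fidelity_gram_bdiag)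
  have Y: "Y \<in> carrier_mat m (n*m)" by (simp add: Y_def)
  obtain U where U: "contraction m (n*m) U" and UY: "adj U * Y = msqrt (adj Y * Y)"
    using polar_decomposition[OF Y] .
  define u where "u i = mat m m (\<lambda>(a,b). U $$ (a, i * m + b))" for i
  have u: "u i \<in> carrier_mat m m" for i by (simp add: u_def)
  have Uu: "U = hcat n m u" unfolding u_def using U by (intro hcat_blocks) (simp add: contraction_def)
  \<comment> \<open>Regrouping U_i* A_i B_i as (A_i U_i)* B_i isolates the block row H of the
    \<open>B i\<close>, which has norm 1; the squared norm of G is the success probability of the
    operators U_i U_i*.\<close>
  define G where "G = hcat n m (\<lambda>i. A i * u i)"
  define H where "H = hcat n m B"
  have AB: "adj (u i) * (A i * B i) = adj (A i * u i) * B i" if "i < n" for i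
    using Ac[OF that] Bc[OF that] u[of i] by (simp add: adj_mult_dim mat_assoc)
  have "mtrace (adj U * Y) = (\<Sum>i<n. mtrace (adj (u i) * (A i * B i)))"
    unfolding Uu Y_def
    by (rule mtrace_adj_hcat_mult_hcat) (use u Ac Bc in \<open>auto intro!: mult_carrier_mat[of _ m m]\<close>)
  also have "\<dots> = (\<Sum>i<n. mtrace (adj (A i * u i) * B i))" by (simp add: AB)
  also have "\<dots> = mtrace (adj G * H)"
    unfolding G_def H_def by (rule mtrace_adj_hcat_mult_hcat[symmetric]) (use u Ac Bc in \<open>auto intro!: mult_carrier_mat[of _ m m]\<close>)
  finally have GH: "mtrace (adj U * Y) = mtrace (adj G * H)" .
  have "mtrace (adj H * H) = (\<Sum>i<n. mtrace (adj (B i) * B i))"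
    unfolding H_def using Bc by (intro mtrace_adj_hcat_mult_hcat) auto
  then have HH: "Re (mtrace (adj H * H)) = 1" using BB Bc by simp
  have "mtrace (adj G * G) = (\<Sum>i<n. mtrace (adj (A i * u i) * (A i * u i)))"
    unfolding G_def by (rule mtrace_adj_hcat_mult_hcat) (use u Ac in \<open>auto intro!: mult_carrier_mat[of _ m m]\<close>)
  also have "\<dots> = (\<Sum>i<n. complex_of_real (\<eta> i) * mtrace (u i * adj (u i) * \<rho> i))"
  proof (rule sum.cong[OF refl])
    fix i assume "i \<in> {..<n}"
    then have i: "i < n" by simp
    have "adj (A i * u i) * (A i * u i) = adj (u i) * ((A i * A i) * u i)"
      using Ac[OF i] u[of i] by (simp add: adj_mult_dim mat_assoc)
    also have "mtrace \<dots> = mtrace ((A i * A i) * u i * adj (u i))"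
      using Ac[OF i] u[of i] by (intro mtrace_comm[of _ m m]) auto
    also have "(A i * A i) * u i * adj (u i) = (A i * A i) * (u i * adj (u i))"
      using Ac[OF i] u[of i] by (simp add: mat_assoc)
    also have "mtrace \<dots> = mtrace ((u i * adj (u i)) * (A i * A i))"
      using Ac[OF i] u[of i] by (intro mtrace_comm[of _ m m]) auto
    also have "(u i * adj (u i)) * (A i * A i) = complex_of_real (\<eta> i) \<cdot>\<^sub>m (u i * adj (u i) * \<rho> i)"
      unfolding AA[OF i] using u[of i] by (intro mult_smult_distrib[of _ m m _ m] \<rho>c i) auto
    also have "mtrace \<dots> = complex_of_real (\<eta> i) * mtrace (u i * adj (u i) * \<rho> i)"
      using \<rho>c[OF i] u[of i] by (intro mtrace_smult[of _ m] mult_carrier_mat[of _ m m]) auto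
    finally show "mtrace (adj (A i * u i) * (A i * u i)) = complex_of_real (\<eta> i) * mtrace (u i * adj (u i) * \<rho> i)" .
  qed
  finally have GG: "Re (mtrace (adj G * G)) = (\<Sum>i<n. \<eta> i * Re (mtrace (u i * adj (u i) * \<rho> i)))"
    by simp
  define R where "R = 1\<^sub>m m - U * adj U"
  have Ud: "dim_row U = m" by (simp add: Uu)
  have R: "psd m R" using U by (simp add: contraction_def R_def)
  \<comment> \<open>The operators U_i U_i* sum only to U U* \<le> 1. The deficit R goes to outcome
    0, which exists as n > 0, and can only raise the success probability.\<close>
  define M where "M i = u i * adj (u i) + (if i = 0 then R else 0\<^sub>m m m)" for i
  have uu: "psd m (u i * adj (u i))" for i using psd_gram[OF adj_carrier[OF u]] by simp
  have "povm n m M"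
    unfolding povm_def
  proof (intro conjI allI impI)
    fix i show "psd m (M i)" unfolding M_def using uu R psd_zero by (intro psd_add) auto
  next
    fix a b assume ab: "a < m" "b < m"
    have "M i $$ (a,b) = (u i * adj (u i)) $$ (a,b) + (if i = 0 then R $$ (a,b) else 0)" for i
      using ab u[of i] psdD(1)[OF R] by (auto simp: M_def)
    then have "(\<Sum>i<n. M i $$ (a,b)) = (\<Sum>i<n. (u i * adj (u i)) $$ (a,b)) + R $$ (a,b)"
      using n by (simp add: sum.distrib)
    also have "(\<Sum>i<n. (u i * adj (u i)) $$ (a,b)) = (U * adj U) $$ (a,b)"
      unfolding Uu using hcat_mult_adj_hcat[of n u m u a b] u ab by simp
    also have "\<dots> + R $$ (a,b) = (if a = b then 1 else 0)"
      using ab Ud unfolding R_def by simp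
    finally show "(\<Sum>i<n. M i $$ (a,b)) = (if a = b then 1 else 0)" .
  qed
  moreover have "(fidelity (adj (hcat n m A) * hcat n m A) (bdiag n m (\<lambda>i. B i * B i)))\<^sup>2 \<le> success_prob n \<eta> \<rho> M"
  proof -
    have "(Re (mtrace (adj G * H)))\<^sup>2 \<le> Re (mtrace (adj G * G)) * Re (mtrace (adj H * H))"
      by (rule Re_mtrace_gram_Cauchy_Schwarz[of _ m "n*m"]) (auto simp: G_def H_def)
    also have "\<dots> = (\<Sum>i<n. \<eta> i * Re (mtrace (u i * adj (u i) * \<rho> i)))" unfolding HH GG by simp
    also have "\<dots> \<le> success_prob n \<eta> \<rho> M"
      unfolding success_prob_def
    proof (intro sum_mono mult_left_mono)
      fix i assume "i \<in> {..<n}"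
      then have i: "i < n" by simp
      show "0 \<le> \<eta> i" using \<eta> i by simp
      let ?R = "if i = 0 then R else 0\<^sub>m m m"
      have R': "psd m ?R" using R psd_zero by simp
      have "M i * \<rho> i = u i * adj (u i) * \<rho> i + ?R * \<rho> i"
        unfolding M_def using psdD(1)[OF uu] psdD(1)[OF R'] \<rho>c[OF i] by (rule add_mult_distrib_mat)
      moreover have "mtrace (u i * adj (u i) * \<rho> i + ?R * \<rho> i) = mtrace (u i * adj (u i) * \<rho> i) + mtrace (?R * \<rho> i)"
        by (rule mtrace_add[OF mult_carrier_mat[OF psdD(1)[OF uu] \<rho>c[OF i]] mult_carrier_mat[OF psdD(1)[OF R'] \<rho>c[OF i]]])
      moreover have "0 \<le> Re (mtrace (?R * \<rho> i))" by (rule psd_trace_mult_nonneg[OF R' \<rho>[OF i]])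
      ultimately show "Re (mtrace (u i * adj (u i) * \<rho> i)) \<le> Re (mtrace (M i * \<rho> i))" by simp
    qed
    finally show ?thesis unfolding F UY[symmetric] GH .
  qed
  ultimately show ?thesis by blast
qed

text \<open>The polar factor W_i makes C_i = W_i* N_i A_i psd, so C_i is a legitimate block, and
  U_i* A_i B_i is C_i^2 / s. The traces of the C_i^2 sum to s^2, so the contraction U certifies a
  trace norm of at least s. Positivity of the success probability permits the division by s.\<close>

lemma success_le_fidelity_square:
  assumes \<rho>: "\<And>i. i < n \<Longrightarrow> psd m (\<rho> i)"
    and A: "\<And>i. i < n \<Longrightarrow> psd m (A i)" and AA: "\<And>i. i < n \<Longrightarrow> A i * A i = complex_of_real (\<eta> i) \<cdot>\<^sub>m \<rho> i"
    and M: "povm n m M" and pos: "0 < success_prob n \<eta> \<rho> M"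
  shows "\<exists>B. (\<forall>i<n. psd m (B i)) \<and> (\<Sum>i<n. Re (mtrace (B i * B i))) = 1 \<and> 
    success_prob n \<eta> \<rho> M \<le> (fidelity (adj (hcat n m A) * hcat n m A) (bdiag n m (\<lambda>i. B i * B i)))\<^sup>2"
proof -
  define s where "s = sqrt (success_prob n \<eta> \<rho> M)"
  have s: "0 < s" and ss: "s\<^sup>2 = success_prob n \<eta> \<rho> M" using pos by (auto simp: s_def)
  have Ac: "A i \<in> carrier_mat m m" "adj (A i) = A i" if "i < n" for i using A[OF that] psdD by blast+
  have \<rho>c: "\<rho> i \<in> carrier_mat m m" if "i < n" for i using \<rho>[OF that] psdD by blast
  have Mp: "psd m (M i)" if "i < n" for i using M that by (simp add: povm_def)
  define N where "N i = msqrt (M i)" for i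
  have N: "N i \<in> carrier_mat m m" "adj (N i) = N i" "N i * N i = M i" if "i < n" for i
    using msqrt[OF Mp[OF that]] psdD unfolding N_def by blast+
  define C where "C i = msqrt (adj (N i * A i) * (N i * A i))" for i
  have NA: "N i * A i \<in> carrier_mat m m" if "i < n" for i using N(1)[OF that] Ac(1)[OF that] by simp
  have C: "psd m (C i)" "C i * C i = adj (N i * A i) * (N i * A i)" if "i < n" for i
    unfolding C_def using msqrt[OF psd_gram[OF NA[OF that]]] by auto
  have Cc: "C i \<in> carrier_mat m m" if "i < n" for i using C(1)[OF that] psdD by blast
  have "\<exists>W. \<forall>i<n. contraction m m (W i) \<and> adj (W i) * (N i * A i) = C i"
  proof -
    have "\<exists>V. contraction m m V \<and> adj V * (N i * A i) = C i" if "i < n" for i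
      unfolding C_def by (rule polar_decomposition[OF NA[OF that]]) blast
    then show ?thesis by metis
  qed
  then obtain W where W: "\<And>i. i < n \<Longrightarrow> contraction m m (W i)" 
    and WC: "\<And>i. i < n \<Longrightarrow> adj (W i) * (N i * A i) = C i" by blast
  have Wc: "W i \<in> carrier_mat m m" if "i < n" for i using W[OF that] by (simp add: contraction_def)
  define u where "u i = N i * W i" for i
  have u: "u i \<in> carrier_mat m m" if "i < n" for i unfolding u_def using N(1)[OF that] Wc[OF that] by simp
  define U where "U = hcat n m u"
  have U: "contraction m (n*m) U"
  proof -
    define Q where "Q i = msqrt (1\<^sub>m m - W i * adj (W i))" for i
    have Q: "Q i \<in> carrier_mat m m" "adj (Q i) = Q i" "Q i * Q i = 1\<^sub>m m - W i * adj (W i)" if "i < n" for i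
      using W[OF that] msqrt[of m "1\<^sub>m m - W i * adj (W i)"] psdD unfolding contraction_def Q_def by blast+
    define Z where "Z = hcat n m (\<lambda>i. N i * Q i)"
    have "Z * adj Z = 1\<^sub>m m - U * adj U"
    proof (rule eq_matI)
      fix a b assume "a < dim_row (1\<^sub>m m - U * adj U)" "b < dim_col (1\<^sub>m m - U * adj U)"
      then have ab: "a < m" "b < m" by (auto simp: U_def)
      have "(Z * adj Z) $$ (a,b) = (\<Sum>i<n. (N i * Q i * adj (N i * Q i)) $$ (a,b))"
        unfolding Z_def using N Q by (intro hcat_mult_adj_hcat ab) (auto intro!: mult_carrier_mat)
      also have "\<dots> = (\<Sum>i<n. M i $$ (a,b) - (u i * adj (u i)) $$ (a,b))"
      proof (rule sum.cong[OF refl])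
        fix i assume "i \<in> {..<n}"
        then have i: "i < n" by simp
        note d = carrier_matD[OF N(1)[OF i]] carrier_matD[OF Q(1)[OF i]] carrier_matD[OF Wc[OF i]]
        have "N i * Q i * adj (N i * Q i) = N i * ((Q i * Q i) * N i)"
          by (simp add: mat_assoc adj_mult_dim d N(2)[OF i] Q(2)[OF i])
        also have "\<dots> = N i * N i - u i * adj (u i)"
          unfolding Q(3)[OF i] u_def using N(1)[OF i]
          by (simp add: mat_assoc adj_mult_dim d N(2)[OF i] minus_mult_distrib_dim mult_minus_distrib_dim)
        finally show "(N i * Q i * adj (N i * Q i)) $$ (a,b) = M i $$ (a,b) - (u i * adj (u i)) $$ (a,b)"
          unfolding N(3)[OF i] using ab u[OF i] by simp
      qed
      also have "\<dots> = (\<Sum>i<n. M i $$ (a,b)) - (\<Sum>i<n. (u i * adj (u i)) $$ (a,b))"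
        by (rule sum_subtractf)
      also have "(\<Sum>i<n. (u i * adj (u i)) $$ (a,b)) = (U * adj U) $$ (a,b)"
        unfolding U_def by (rule hcat_mult_adj_hcat[symmetric]) (use u ab in auto)
      also have "(\<Sum>i<n. M i $$ (a,b)) = 1\<^sub>m m $$ (a,b)" using M ab by (simp add: povm_def)
      finally show "(Z * adj Z) $$ (a,b) = (1\<^sub>m m - U * adj U) $$ (a,b)" using ab by (simp add: U_def)
    qed (auto simp: Z_def U_def)
    moreover have "psd m (Z * adj Z)" using psd_gram[of "adj Z" "n*m" m] by (simp add: Z_def)
    ultimately show ?thesis by (simp add: contraction_def U_def)
  qed
  define B where "B i = complex_of_real (1 / s) \<cdot>\<^sub>m C i" for i
  have B: "psd m (B i)" if "i < n" for i unfolding B_def using C(1)[OF that] s by (intro psd_smult) auto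
  have Bc: "B i \<in> carrier_mat m m" if "i < n" for i using B[OF that] psdD by blast
  \<comment> \<open>C_i^2 = A_i N_i^2 A_i = A_i M_i A_i, and cyclicity brings the two factors A_i
    together to \<eta>_i \<rho>_i.\<close>
  have trCC: "Re (mtrace (C i * C i)) = \<eta> i * Re (mtrace (M i * \<rho> i))" if i: "i < n" for i
  proof -
    note d = carrier_matD[OF N(1)[OF i]] carrier_matD[OF Ac(1)[OF i]]
    have "C i * C i = A i * (M i * A i)"
      unfolding C(2)[OF i] N(3)[OF i, symmetric] by (simp add: mat_assoc adj_mult_dim d N(2)[OF i] Ac(2)[OF i])
    also have "mtrace \<dots> = mtrace (M i * A i * A i)"
      using Ac(1)[OF i] psdD(1)[OF Mp[OF i]] by (intro mtrace_comm[of _ m m]) auto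
    also have "M i * A i * A i = M i * (A i * A i)"
      using Ac(1)[OF i] psdD(1)[OF Mp[OF i]] by (simp add: mat_assoc)
    also have "\<dots> = complex_of_real (\<eta> i) \<cdot>\<^sub>m (M i * \<rho> i)"
      unfolding AA[OF i] by (rule mult_smult_distrib[OF psdD(1)[OF Mp[OF i]] \<rho>c[OF i]])
    also have "mtrace \<dots> = complex_of_real (\<eta> i) * mtrace (M i * \<rho> i)"
      by (rule mtrace_smult[OF mult_carrier_mat[OF psdD(1)[OF Mp[OF i]] \<rho>c[OF i]]])
    finally show ?thesis by simp
  qed
  have sumC: "(\<Sum>i<n. Re (mtrace (C i * C i))) = s\<^sup>2"
    unfolding ss success_prob_def by (intro sum.cong trCC) auto
  have BB: "mtrace (B i * B i) = complex_of_real (1 / s\<^sup>2) * mtrace (C i * C i)" if i: "i < n" for i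
  proof -
    have "B i * B i = complex_of_real (1 / s) \<cdot>\<^sub>m (complex_of_real (1 / s) \<cdot>\<^sub>m (C i * C i))"
      unfolding B_def using Cc[OF i] by (simp add: mult_smult_distrib[of _ m m _ m] mult_smult_assoc_mat[of _ m m _ m])
    then show ?thesis using Cc[OF i]
      by (simp add: mtrace_smult[of _ m] power2_eq_square)
  qed
  have "(\<Sum>i<n. Re (mtrace (B i * B i))) = (\<Sum>i<n. (1 / s\<^sup>2) * Re (mtrace (C i * C i)))"
  proof (intro sum.cong refl)
    fix i assume "i \<in> {..<n}"
    then show "Re (mtrace (B i * B i)) = (1 / s\<^sup>2) * Re (mtrace (C i * C i))"
      by (simp add: BB del: of_real_divide)
  qed
  then have B1: "(\<Sum>i<n. Re (mtrace (B i * B i))) = 1"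
    using s by (simp only: sum_distrib_left[symmetric] sumC) simp
  define Y where "Y = hcat n m (\<lambda>i. A i * B i)"
  have F: "fidelity (adj (hcat n m A) * hcat n m A) (bdiag n m (\<lambda>i. B i * B i)) = Re (mtrace (msqrt (adj Y * Y)))"
    unfolding Y_def using Ac B by (intro fidelity_gram_bdiag)
  have AB: "adj (u i) * (A i * B i) = complex_of_real (1 / s) \<cdot>\<^sub>m (C i * C i)" if i: "i < n" for i
  proof -
    note d = carrier_matD[OF N(1)[OF i]] carrier_matD[OF Ac(1)[OF i]] carrier_matD[OF Wc[OF i]] carrier_matD[OF Bc[OF i]]
    have "adj (u i) * (A i * B i) = (adj (W i) * (N i * A i)) * B i"
      unfolding u_def by (simp add: mat_assoc adj_mult_dim d N(2)[OF i])
    also have "\<dots> = complex_of_real (1 / s) \<cdot>\<^sub>m (C i * C i)"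
      unfolding WC[OF i] B_def by (rule mult_smult_distrib[OF Cc[OF i] Cc[OF i]])
    finally show ?thesis .
  qed
  have "mtrace (adj U * Y) = (\<Sum>i<n. mtrace (adj (u i) * (A i * B i)))"
    unfolding U_def Y_def
    by (rule mtrace_adj_hcat_mult_hcat) (use u Ac Bc in \<open>auto intro!: mult_carrier_mat[of _ m m]\<close>)
  also have "\<dots> = (\<Sum>i<n. complex_of_real (1 / s) * mtrace (C i * C i))"
  proof (intro sum.cong refl)
    fix i assume "i \<in> {..<n}"
    then have i: "i < n" by simp
    show "mtrace (adj (u i) * (A i * B i)) = complex_of_real (1 / s) * mtrace (C i * C i)"
      unfolding AB[OF i] by (rule mtrace_smult[OF mult_carrier_mat[OF Cc[OF i] Cc[OF i]]])
  qed
  finally have "Re (mtrace (adj U * Y)) = (\<Sum>i<n. (1 / s) * Re (mtrace (C i * C i)))"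
    by (simp del: of_real_divide)
  also have "\<dots> = (1 / s) * s\<^sup>2" unfolding sum_distrib_left[symmetric] sumC ..
  also have "\<dots> = s" using s by (simp add: power2_eq_square)
  \<comment> \<open>U is one admissible contraction in the variational bound; it need not be the
    polar factor of Y.\<close>
  finally have "s \<le> Re (mtrace (msqrt (adj Y * Y)))"
    using trace_norm_upper[OF _ U, of Y] by (simp add: Y_def)
  then have "s\<^sup>2 \<le> (Re (mtrace (msqrt (adj Y * Y))))\<^sup>2" using s by (intro power_mono) auto
  then show ?thesis unfolding ss F[symmetric] using B B1 by blast
qed

text \<open>Each tr(M_i \<rho>_i) is at most the sum of tr(M_j \<rho>_i) over all j, which is tr
  \<rho>_i = 1 by completeness. This bound makes the supremum in \<open>PoptE\<close>
  meaningful.\<close>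

lemma success_prob_le_1:
  assumes dens: "\<forall>i<n. density m (\<rho> i)" and \<eta>: "\<forall>i<n. 0 \<le> \<eta> i" and sum1: "(\<Sum>i<n. \<eta> i) = 1"
    and M: "povm n m M"
  shows "success_prob n \<eta> \<rho> M \<le> 1"
proof -
  have "Re (mtrace (M i * \<rho> i)) \<le> 1" if i: "i < n" for i
  proof -
    have \<rho>: "psd m (\<rho> i)" "mtrace (\<rho> i) = 1" using dens i by (auto simp: density_def)
    have Mp: "psd m (M j)" if "j < n" for j using M that by (simp add: povm_def)
    have "Re (mtrace (M i * \<rho> i)) \<le> (\<Sum>j<n. Re (mtrace (M j * \<rho> i)))"
      using i by (intro member_le_sum psd_trace_mult_nonneg[OF Mp \<rho>(1)]) auto
    also have "\<dots> = Re (\<Sum>j<n. \<Sum>a<m. \<Sum>b<m. M j $$ (a,b) * \<rho> i $$ (b,a))"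
      by (simp add: mtrace_mult[OF psdD(1)[OF Mp] psdD(1)[OF \<rho>(1)]])
    also have "(\<Sum>j<n. \<Sum>a<m. \<Sum>b<m. M j $$ (a,b) * \<rho> i $$ (b,a)) = (\<Sum>a<m. \<Sum>b<m. (\<Sum>j<n. M j $$ (a,b)) * \<rho> i $$ (b,a))"
      unfolding sum_distrib_right
      by (subst sum.swap) (intro sum.cong refl sum.swap)
    also have "\<dots> = (\<Sum>a<m. \<Sum>b<m. (if a = b then 1 else 0) * \<rho> i $$ (b,a))"
      using M by (intro sum.cong refl) (auto simp: povm_def)
    also have "\<dots> = mtrace (\<rho> i)"
      using psdD(1)[OF \<rho>(1)] by (simp add: mtrace_def if_distrib[of "\<lambda>x. x * _"] cong: if_cong)
    finally show ?thesis using \<rho> by simp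
  qed
  then have "success_prob n \<eta> \<rho> M \<le> (\<Sum>i<n. \<eta> i * 1)"
    unfolding success_prob_def using \<eta> by (intro sum_mono mult_left_mono) auto
  then show ?thesis using sum1 by simp
qed

text \<open>Every partial incoherent state is matched by a POVM whose success probability is at
  least the squared fidelity, and every POVM by a state whose squared fidelity is at least the
  success probability. So the two suprema agree.\<close>

theorem PoptE_eq_CaF_qsd_state:
  assumes dens: "\<forall>i<n. density m (\<rho> i)" and \<eta>: "\<forall>i<n. 0 \<le> \<eta> i" and sum1: "(\<Sum>i<n. \<eta> i) = 1"
  shows "PoptE n m \<eta> \<rho> = CaF n m (qsd_state n m \<eta> \<rho>)"
proof -
  have n: "0 < n" using sum1 by (cases n) auto
  have \<rho>: "psd m (\<rho> i)" if "i < n" for i using dens that by (simp add: density_def)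
  have \<eta>\<rho>: "psd m (complex_of_real (\<eta> i) \<cdot>\<^sub>m \<rho> i)" if "i < n" for i using \<rho> \<eta> that by (intro psd_smult) auto
  define A where "A i = msqrt (complex_of_real (\<eta> i) \<cdot>\<^sub>m \<rho> i)" for i
  have A: "psd m (A i)" "A i * A i = complex_of_real (\<eta> i) \<cdot>\<^sub>m \<rho> i" if "i < n" for i
    using msqrt[OF \<eta>\<rho>[OF that]] by (auto simp: A_def)
  define Q where "Q = adj (hcat n m A) * hcat n m A"
  have qsd: "qsd_state n m \<eta> \<rho> = Q"
    unfolding Q_def A_def using \<eta>\<rho> by (rule qsd_state_eq_gram)
  define P where "P = {M. povm n m M}"
  let ?S = "success_prob n \<eta> \<rho>"
  have \<delta>: "density m (\<rho> 0)" using dens n by simp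
  \<comment> \<open>Each block is replaced by its square root, the parametrization in which the two
    comparison lemmas are stated.\<close>
  have PI: "\<sigma> \<in> partial_incoherent n m \<longleftrightarrow> (\<exists>B. (\<forall>i<n. psd m (B i)) \<and> (\<Sum>i<n. Re (mtrace (B i * B i))) = 1 \<and>
      \<sigma> = bdiag n m (\<lambda>i. B i * B i))" for \<sigma>
  proof
    assume "\<sigma> \<in> partial_incoherent n m"
    then obtain X where X: "\<forall>i<n. psd m (X i)" "(\<Sum>i<n. Re (mtrace (X i))) = 1" "\<sigma> = bdiag n m X"
      unfolding partial_incoherent_eq[OF \<delta>] by blast
    have sq: "psd m (msqrt (X i))" "msqrt (X i) * msqrt (X i) = X i" if "i < n" for i
      using msqrt[of m "X i"] X(1) that by auto
    have "\<sigma> = bdiag n m (\<lambda>i. msqrt (X i) * msqrt (X i))" unfolding X(3) by (rule bdiag_cong) (simp add: sq)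
    moreover have "(\<Sum>i<n. Re (mtrace (msqrt (X i) * msqrt (X i)))) = 1" using X(2) by (simp add: sq)
    ultimately show "\<exists>B. (\<forall>i<n. psd m (B i)) \<and> (\<Sum>i<n. Re (mtrace (B i * B i))) = 1 \<and> \<sigma> = bdiag n m (\<lambda>i. B i * B i)"
      using sq(1) by (intro exI[of _ "\<lambda>i. msqrt (X i)"] conjI allI impI)
  next
    assume "\<exists>B. (\<forall>i<n. psd m (B i)) \<and> (\<Sum>i<n. Re (mtrace (B i * B i))) = 1 \<and> \<sigma> = bdiag n m (\<lambda>i. B i * B i)"
    then obtain B where B: "\<forall>i<n. psd m (B i)" "(\<Sum>i<n. Re (mtrace (B i * B i))) = 1" "\<sigma> = bdiag n m (\<lambda>i. B i * B i)"
      by blast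
    have "psd m (B i * B i)" if "i < n" for i
      using B(1) that psd_gram[of "B i" m m] psdD[of m "B i"] by simp
    then show "\<sigma> \<in> partial_incoherent n m"
      unfolding partial_incoherent_eq[OF \<delta>] mem_Collect_eq B(3) using B(2)
      by (intro exI[of _ "\<lambda>i. B i * B i"] conjI refl allI impI)
  qed
  have bdd: "bdd_above (?S ` P)"
    using success_prob_le_1[OF dens \<eta> sum1] by (auto simp: P_def intro!: bdd_aboveI[of _ 1])
  have upper_witness: "\<exists>M\<in>P. (fidelity Q \<sigma>)\<^sup>2 \<le> ?S M" if \<sigma>: "\<sigma> \<in> partial_incoherent n m" for \<sigma>
  proof -
    from \<sigma> obtain B where B: "\<And>i. i < n \<Longrightarrow> psd m (B i)" "(\<Sum>i<n. Re (mtrace (B i * B i))) = 1"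
      and eq: "\<sigma> = bdiag n m (\<lambda>i. B i * B i)" unfolding PI by blast
    have "\<exists>M. povm n m M \<and> (fidelity Q \<sigma>)\<^sup>2 \<le> ?S M"
      unfolding Q_def eq using \<eta> by (intro fidelity_square_le_success[OF n \<rho> _ A B]) auto
    then show ?thesis by (auto simp: P_def)
  qed
  have upper: "(fidelity Q \<sigma>)\<^sup>2 \<le> Sup (?S ` P)" if "\<sigma> \<in> partial_incoherent n m" for \<sigma>
    using upper_witness[OF that] cSUP_upper[OF _ bdd] by (meson order_trans)
  \<comment> \<open>The infimum needs a nonempty range; all the weight is put on the first
    block.\<close>
  obtain \<sigma>0 where \<sigma>0: "\<sigma>0 \<in> partial_incoherent n m"
  proof -
    let ?X = "\<lambda>i. if i = 0 then \<rho> 0 else 0\<^sub>m m m"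
    have "(\<Sum>i<n. Re (mtrace (?X i))) = (\<Sum>i<n. if i = 0 then 1 else 0)"
    proof (rule sum.cong[OF refl])
      have "mtrace (\<rho> 0) = 1" "mtrace (0\<^sub>m m m) = 0" using \<delta> by (simp_all add: density_def) (simp add: mtrace_def)
      then show "Re (mtrace (?X i)) = (if i = 0 then 1 else 0)" for i by simp
    qed
    also have "\<dots> = 1" using n by simp
    finally have "bdiag n m ?X \<in> partial_incoherent n m"
      unfolding partial_incoherent_eq[OF \<delta>] using \<rho>[OF n] psd_zero by auto
    then show ?thesis using that by blast
  qed
  have lbdd: "bdd_below ((\<lambda>\<sigma>. 1 - (fidelity Q \<sigma>)\<^sup>2) ` partial_incoherent n m)"
    using upper by (intro bdd_belowI[of _ "1 - Sup (?S ` P)"]) auto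
  have "PoptE n m \<eta> \<rho> \<le> CaF n m Q"
    unfolding PoptE_def CaF_def P_def[symmetric] using \<sigma>0 upper by (intro cINF_greatest) auto
  moreover have "CaF n m Q \<le> PoptE n m \<eta> \<rho>"
  proof -
    have "?S M \<le> 1 - CaF n m Q" if M: "M \<in> P" for M
    proof -
      have "\<exists>\<sigma>\<in>partial_incoherent n m. ?S M \<le> (fidelity Q \<sigma>)\<^sup>2"
      proof (cases "0 < ?S M")
        case True
        from success_le_fidelity_square[OF \<rho> A _ True] M
        obtain B where "\<forall>i<n. psd m (B i)" "(\<Sum>i<n. Re (mtrace (B i * B i))) = 1"
          "?S M \<le> (fidelity Q (bdiag n m (\<lambda>i. B i * B i)))\<^sup>2"
          by (auto simp: P_def Q_def)
        then show ?thesis by (intro bexI[of _ "bdiag n m (\<lambda>i. B i * B i)"]) (auto simp: PI)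
      next
        case False
        \<comment> \<open>A nonpositive success probability is bounded by any square, so \<sigma>0
          serves as the witness.\<close>
        then have "?S M \<le> (fidelity Q \<sigma>0)\<^sup>2" using zero_le_power2[of "fidelity Q \<sigma>0"] by linarith
        then show ?thesis using \<sigma>0 by blast
      qed
      then obtain \<sigma> where \<sigma>: "\<sigma> \<in> partial_incoherent n m" "?S M \<le> (fidelity Q \<sigma>)\<^sup>2" by blast
      have "CaF n m Q \<le> 1 - (fidelity Q \<sigma>)\<^sup>2" unfolding CaF_def by (rule cINF_lower[OF lbdd \<sigma>(1)])
      with \<sigma>(2) show ?thesis by simp
    qed
    moreover have "P \<noteq> {}" using upper_witness[OF \<sigma>0] by blast
    ultimately have "Sup (?S ` P) \<le> 1 - CaF n m Q" by (intro cSUP_least) auto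
    then show ?thesis unfolding PoptE_def P_def[symmetric] by simp
  qed
  ultimately show ?thesis unfolding qsd by simp
qed

theorem theorem4:
  fixes n m :: nat and \<eta> :: "nat \<Rightarrow> real" and \<rho> :: "nat \<Rightarrow> complex mat"
  assumes dens: "\<forall>i<n. density m (\<rho> i)"
    and pos: "\<forall>i<n. 0 < \<eta> i"
    and sum1: "(\<Sum>i<n. \<eta> i) = 1"
  shows "PoptE n m \<eta> \<rho> \<le> CaF n m (qsd_state n m \<eta> \<rho>) \<and>
         (lin_indep_states n m \<rho> \<longrightarrow> PoptE n m \<eta> \<rho> = CaF n m (qsd_state n m \<eta> \<rho>))"
  using PoptE_eq_CaF_qsd_state[OF dens _ sum1] pos by (simp add: less_imp_le)

end
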